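(* Let $n\ge 2$ and let $T\in\overline{cv}_n$ have dense orbits. Suppose that $T$ does not split as a graph of actions and that $T$ contains an exceptional set $X$. Then there is a non-zero $\mu\in M_0(T)$ supported on $X$.
   Context: $\overline{cv}_n$ is the set of $\mathbb{R}$-trees with a very small isometric action of the free group $F_n$ of rank $n$: minimal, non-trivial, stabilizers of non-degenerate arcs are trivial or maximal cyclic, and tripod stabilizers are trivial. $T$ has dense orbits if some (equivalently every) $F_n$-orbit is dense in $T$. A transverse covering of $T$ is an $F_n$-invariant family of closed non-degenerate subtrees of $T$ such that any two distinct members meet in at most one point and every finite arc of $T$ is contained in a union of finitely many members. $T$ splits as a graph of actions if it has a transverse covering different from $\{T\}$. An $F_n$-invariant subset $X\subseteq T$ is exceptional if for every finite subtree $K\subseteq T$ the set $X\cap K$ is closed and nowhere dense in $K$, and there is a finite subtree $K_0\subseteq T$ such that $X\cap K_0$ contains a Cantor set. A length measure $\mu$ on $T$ is a collection $\{\mu_I\}$ of finite positive Borel measures $\mu_I$ on the finite arcs $I\subseteq T$ with $\mu_J=(\mu_I)|_J$ whenever $J\subseteq I$. It is invariant if $\mu_{gI}(g(A\cap I))=\mu_I(A\cap I)$ for all $g\in F_n$ and measurable $A$. $M_0(T)$ is the set of non-atomic $F_n$-invariant length measures. For a finite subtree $K=I_1\cup\dots\cup I_l$ ($I_j$ arcs), $\mathrm{Supp}_K(\mu)$ is the union of the supports of the $\mu_{I_j}$; $\mu$ is supported on $X$ if $\mathrm{Supp}_K(\mu)\subseteq K\cap X$ for every finite subtree $K$. *)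

theory Defs
  imports "HOL-Analysis.Analysis" "HOL-Algebra.Group_Action" "HOL-Algebra.Generated_Groups"
begin

section \<open>Free groups of finite rank\<close>

text \<open>A word is a list of letters \<open>(s, b)\<close>, standing for \<open>s\<close> if \<open>b\<close> is true and for the inverse
  of \<open>s\<close> otherwise.\<close>

definition reduced_word :: "('g \<times> bool) list \<Rightarrow> bool" where
  "reduced_word w \<longleftrightarrow> successively (\<lambda>a b. \<not> (fst a = fst b \<and> snd a \<noteq> snd b)) w"

definition word_value :: "('g, 'm) monoid_scheme \<Rightarrow> ('g \<times> bool) list \<Rightarrow> 'g" where
  "word_value G w =
     foldr (\<lambda>(s, b) x. (if b then s else inv\<^bsub>G\<^esub> s) \<otimes>\<^bsub>G\<^esub> x) w \<one>\<^bsub>G\<^esub>"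

definition free_basis :: "('g, 'm) monoid_scheme \<Rightarrow> 'g set \<Rightarrow> bool" where
  "free_basis G S \<longleftrightarrow>
     S \<subseteq> carrier G \<and> generate G S = carrier G \<and>
     (\<forall>w. w \<noteq> [] \<and> fst ` set w \<subseteq> S \<and> reduced_word w \<longrightarrow> word_value G w \<noteq> \<one>\<^bsub>G\<^esub>)"

definition free_group_of_rank :: "('g, 'm) monoid_scheme \<Rightarrow> nat \<Rightarrow> bool" where
  "free_group_of_rank G n \<longleftrightarrow>
     group G \<and> (\<exists>S. free_basis G S \<and> finite S \<and> card S = n)"

text \<open>The trivial subgroup is maximal cyclic only if \<open>G\<close> itself is trivial.\<close>

definition maximal_cyclic :: "('g, 'm) monoid_scheme \<Rightarrow> 'g set \<Rightarrow> bool" where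
  "maximal_cyclic G H \<longleftrightarrow>
     (\<exists>g\<in>carrier G. H = generate G {g}) \<and>
     (\<forall>h\<in>carrier G. H \<subseteq> generate G {h} \<longrightarrow> generate G {h} = H)"


section \<open>Real trees\<close>

text \<open>The tree is the whole universe of a type of class \<open>metric_space\<close>.\<close>

definition geodesic_segment :: "'a::metric_space \<Rightarrow> 'a \<Rightarrow> 'a set \<Rightarrow> bool" where
  "geodesic_segment x y I \<longleftrightarrow>
     (\<exists>\<gamma>::real \<Rightarrow> 'a.
        (\<forall>s\<in>{0..dist x y}. \<forall>t\<in>{0..dist x y}. dist (\<gamma> s) (\<gamma> t) = \<bar>s - t\<bar>) \<and>
        \<gamma> 0 = x \<and> \<gamma> (dist x y) = y \<and> I = \<gamma> ` {0..dist x y})"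

definition real_tree :: "'a::metric_space itself \<Rightarrow> bool" where
  "real_tree _ \<longleftrightarrow>
     (\<forall>x y::'a. \<exists>I. geodesic_segment x y I) \<and>
     (\<forall>p q::real \<Rightarrow> 'a. arc p \<and> arc q \<and> pathstart p = pathstart q \<and> pathfinish p = pathfinish q
        \<longrightarrow> path_image p = path_image q)"

text \<open>The finite arcs of a tree; degenerate arcs \<open>{x}\<close> are allowed. (The library's \<open>arc\<close> is a
  property of parametrized paths.)\<close>

definition finite_arc :: "'a::metric_space set \<Rightarrow> bool" where
  "finite_arc I \<longleftrightarrow> (\<exists>x y. geodesic_segment x y I)"

definition nondegenerate :: "'a set \<Rightarrow> bool" where
  "nondegenerate S \<longleftrightarrow> (\<exists>x\<in>S. \<exists>y\<in>S. x \<noteq> y)"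

text \<open>The convex subsets of a real tree are its connected subsets.\<close>

definition subtree :: "'a::metric_space set \<Rightarrow> bool" where
  "subtree S \<longleftrightarrow> S \<noteq> {} \<and> connected S"

definition arc_decomposition :: "'a::metric_space set set \<Rightarrow> 'a set \<Rightarrow> bool" where
  "arc_decomposition \<I> K \<longleftrightarrow> finite \<I> \<and> (\<forall>I\<in>\<I>. finite_arc I) \<and> \<Union>\<I> = K"

definition finite_subtree :: "'a::metric_space set \<Rightarrow> bool" where
  "finite_subtree K \<longleftrightarrow> subtree K \<and> (\<exists>\<I>. arc_decomposition \<I> K)"

definition tripod :: "'a::metric_space set \<Rightarrow> bool" where
  "tripod P \<longleftrightarrow>
     (\<exists>c x y z I J K.
        x \<noteq> c \<and> y \<noteq> c \<and> z \<noteq> c \<and>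
        geodesic_segment c x I \<and> geodesic_segment c y J \<and> geodesic_segment c z K \<and>
        I \<inter> J = {c} \<and> I \<inter> K = {c} \<and> J \<inter> K = {c} \<and> P = I \<union> J \<union> K)"


section \<open>Very small actions\<close>

definition isometric_action ::
    "('g, 'm) monoid_scheme \<Rightarrow> ('g \<Rightarrow> 'a::metric_space \<Rightarrow> 'a) \<Rightarrow> bool" where
  "isometric_action G \<phi> \<longleftrightarrow>
     group_action G (UNIV :: 'a set) \<phi> \<and>
     (\<forall>g\<in>carrier G. \<forall>x y. dist (\<phi> g x) (\<phi> g y) = dist x y)"

definition pointwise_stabilizer ::
    "('g, 'm) monoid_scheme \<Rightarrow> ('g \<Rightarrow> 'a \<Rightarrow> 'a) \<Rightarrow> 'a set \<Rightarrow> 'g set" where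
  "pointwise_stabilizer G \<phi> S = {g \<in> carrier G. \<forall>x\<in>S. \<phi> g x = x}"

definition invariant_set ::
    "('g, 'm) monoid_scheme \<Rightarrow> ('g \<Rightarrow> 'a \<Rightarrow> 'a) \<Rightarrow> 'a set \<Rightarrow> bool" where
  "invariant_set G \<phi> X \<longleftrightarrow> (\<forall>g\<in>carrier G. \<phi> g ` X = X)"

definition minimal_action ::
    "('g, 'm) monoid_scheme \<Rightarrow> ('g \<Rightarrow> 'a::metric_space \<Rightarrow> 'a) \<Rightarrow> bool" where
  "minimal_action G \<phi> \<longleftrightarrow> (\<forall>S. subtree S \<and> invariant_set G \<phi> S \<longrightarrow> S = UNIV)"

definition nontrivial_action ::
    "('g, 'm) monoid_scheme \<Rightarrow> ('g \<Rightarrow> 'a \<Rightarrow> 'a) \<Rightarrow> bool" where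
  "nontrivial_action G \<phi> \<longleftrightarrow> \<not> (\<exists>x. \<forall>g\<in>carrier G. \<phi> g x = x)"

definition very_small_action ::
    "('g, 'm) monoid_scheme \<Rightarrow> ('g \<Rightarrow> 'a::metric_space \<Rightarrow> 'a) \<Rightarrow> bool" where
  "very_small_action G \<phi> \<longleftrightarrow>
     isometric_action G \<phi> \<and> minimal_action G \<phi> \<and> nontrivial_action G \<phi> \<and>
     (\<forall>I. finite_arc I \<and> nondegenerate I \<longrightarrow>
        pointwise_stabilizer G \<phi> I = {\<one>\<^bsub>G\<^esub>} \<or> maximal_cyclic G (pointwise_stabilizer G \<phi> I)) \<and>
     (\<forall>P. tripod P \<longrightarrow> pointwise_stabilizer G \<phi> P = {\<one>\<^bsub>G\<^esub>})"

text \<open>\<open>cv_bar n G \<phi>\<close>: the tree \<open>'a\<close> with the action \<open>\<phi>\<close> of \<open>G = F\<^sub>n\<close> belongs to the closure of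
  unprojectivized outer space.\<close>

definition cv_bar ::
    "nat \<Rightarrow> ('g, 'm) monoid_scheme \<Rightarrow> ('g \<Rightarrow> 'a::metric_space \<Rightarrow> 'a) \<Rightarrow> bool" where
  "cv_bar n G \<phi> \<longleftrightarrow>
     free_group_of_rank G n \<and> real_tree TYPE('a) \<and> very_small_action G \<phi>"

definition dense_orbits ::
    "('g, 'm) monoid_scheme \<Rightarrow> ('g \<Rightarrow> 'a::metric_space \<Rightarrow> 'a) \<Rightarrow> bool" where
  "dense_orbits G \<phi> \<longleftrightarrow> (\<exists>x. closure (orbit G \<phi> x) = UNIV)"


section \<open>Transverse coverings and exceptional sets\<close>

definition transverse_covering ::
    "('g, 'm) monoid_scheme \<Rightarrow> ('g \<Rightarrow> 'a::metric_space \<Rightarrow> 'a) \<Rightarrow> 'a set set \<Rightarrow> bool" where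
  "transverse_covering G \<phi> \<Y> \<longleftrightarrow>
     (\<forall>Y\<in>\<Y>. closed Y \<and> subtree Y \<and> nondegenerate Y) \<and>
     (\<forall>g\<in>carrier G. \<forall>Y\<in>\<Y>. \<phi> g ` Y \<in> \<Y>) \<and>
     (\<forall>Y\<in>\<Y>. \<forall>Z\<in>\<Y>. Y \<noteq> Z \<longrightarrow> (\<forall>x\<in>Y \<inter> Z. \<forall>y\<in>Y \<inter> Z. x = y)) \<and>
     (\<forall>I. finite_arc I \<longrightarrow> (\<exists>\<F>\<subseteq>\<Y>. finite \<F> \<and> I \<subseteq> \<Union>\<F>))"

definition splits_as_graph_of_actions ::
    "('g, 'm) monoid_scheme \<Rightarrow> ('g \<Rightarrow> 'a::metric_space \<Rightarrow> 'a) \<Rightarrow> bool" where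
  "splits_as_graph_of_actions G \<phi> \<longleftrightarrow> (\<exists>\<Y>. transverse_covering G \<phi> \<Y> \<and> \<Y> \<noteq> {UNIV})"

definition nowhere_dense_in :: "'a topology \<Rightarrow> 'a set \<Rightarrow> bool" where
  "nowhere_dense_in X S \<longleftrightarrow> X interior_of (X closure_of S) = {}"

definition cantor_set :: "'a::topological_space set \<Rightarrow> bool" where
  "cantor_set C \<longleftrightarrow>
     top_of_set C homeomorphic_space
       product_topology (\<lambda>_::nat. discrete_topology (UNIV :: bool set)) UNIV"

text \<open>The finite subtrees have to be non-degenerate here: a point of \<open>X\<close> is not nowhere dense in
  the one-point subtree consisting of it.\<close>

definition exceptional_set ::
    "('g, 'm) monoid_scheme \<Rightarrow> ('g \<Rightarrow> 'a::metric_space \<Rightarrow> 'a) \<Rightarrow> 'a set \<Rightarrow> bool" where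
  "exceptional_set G \<phi> X \<longleftrightarrow>
     invariant_set G \<phi> X \<and>
     (\<forall>K. finite_subtree K \<and> nondegenerate K \<longrightarrow>
        closedin (top_of_set K) (X \<inter> K) \<and> nowhere_dense_in (top_of_set K) (X \<inter> K)) \<and>
     (\<exists>K C. finite_subtree K \<and> C \<subseteq> X \<inter> K \<and> cantor_set C)"


section \<open>Length measures\<close>

text \<open>A length measure is represented by a function on all sets of which only the values at
  finite arcs matter.\<close>

definition length_measure :: "('a::metric_space set \<Rightarrow> 'a measure) \<Rightarrow> bool" where
  "length_measure \<mu> \<longleftrightarrow>
     (\<forall>I. finite_arc I \<longrightarrow>
        space (\<mu> I) = I \<and> sets (\<mu> I) = sets (restrict_space borel I) \<and> finite_measure (\<mu> I)) \<and>
     (\<forall>I J. finite_arc I \<and> finite_arc J \<and> J \<subseteq> I \<longrightarrow> \<mu> J = restrict_space (\<mu> I) J)"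

definition invariant_length_measure ::
    "('g, 'm) monoid_scheme \<Rightarrow> ('g \<Rightarrow> 'a \<Rightarrow> 'a) \<Rightarrow> ('a::metric_space set \<Rightarrow> 'a measure) \<Rightarrow> bool"
  where
  "invariant_length_measure G \<phi> \<mu> \<longleftrightarrow>
     length_measure \<mu> \<and>
     (\<forall>g\<in>carrier G. \<forall>I. finite_arc I \<longrightarrow>
        (\<forall>A\<in>sets borel. emeasure (\<mu> (\<phi> g ` I)) (\<phi> g ` (A \<inter> I)) = emeasure (\<mu> I) (A \<inter> I)))"

definition nonatomic_length_measure :: "('a::metric_space set \<Rightarrow> 'a measure) \<Rightarrow> bool" where
  "nonatomic_length_measure \<mu> \<longleftrightarrow>
     (\<forall>I. finite_arc I \<longrightarrow> (\<forall>x\<in>I. emeasure (\<mu> I) {x} = 0))"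

definition M0 ::
    "('g, 'm) monoid_scheme \<Rightarrow> ('g \<Rightarrow> 'a \<Rightarrow> 'a) \<Rightarrow> ('a::metric_space set \<Rightarrow> 'a measure) set"
  where
  "M0 G \<phi> = {\<mu>. invariant_length_measure G \<phi> \<mu> \<and> nonatomic_length_measure \<mu>}"

definition nonzero_length_measure :: "('a::metric_space set \<Rightarrow> 'a measure) \<Rightarrow> bool" where
  "nonzero_length_measure \<mu> \<longleftrightarrow> (\<exists>I. finite_arc I \<and> emeasure (\<mu> I) I \<noteq> 0)"

definition measure_support :: "'a::topological_space measure \<Rightarrow> 'a set" where
  "measure_support M =
     {x \<in> space M. \<forall>U. open U \<and> x \<in> U \<longrightarrow> emeasure M (U \<inter> space M) \<noteq> 0}"

text \<open>For a length measure, the union of the supports over the arcs of a decomposition of \<open>K\<close> does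
  not depend on the decomposition; the definition takes the union over all decompositions
  instead of choosing one.\<close>

definition Supp :: "'a::metric_space set \<Rightarrow> ('a set \<Rightarrow> 'a measure) \<Rightarrow> 'a set" where
  "Supp K \<mu> = (\<Union>\<I>\<in>{\<I>. arc_decomposition \<I> K}. \<Union>I\<in>\<I>. measure_support (\<mu> I))"

definition supported_on :: "('a::metric_space set \<Rightarrow> 'a measure) \<Rightarrow> 'a set \<Rightarrow> bool" where
  "supported_on \<mu> X \<longleftrightarrow> (\<forall>K. finite_subtree K \<longrightarrow> Supp K \<mu> \<subseteq> K \<inter> X)"

end

theory Submission
  imports Defs
begin

text \<open>
  For \<open>\<epsilon> > 0\<close> let \<open>P\<^sub>\<epsilon>(p, q)\<close> be the largest size of an \<open>\<epsilon>\<close>-separated subset of \<open>X \<inter> [p, q]\<close>. This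
  function is invariant under the isometric action, satisfies the triangle inequality and is
  additive along segments up to an error of 1. Let \<open>N\<^sub>\<epsilon>\<close> be the sum of \<open>P\<^sub>\<epsilon>(x, s x)\<close> over a finite
  generating set. By minimality every \<open>P\<^sub>\<epsilon>(p, q)\<close> is bounded by a multiple of \<open>N\<^sub>\<epsilon> + 1\<close>, and
  \<open>N\<^sub>\<epsilon>\<close> tends to infinity because some arc meets \<open>X\<close> in an infinite set. As in the construction
  of the Haar measure, a cluster point of \<open>P\<^sub>\<epsilon> / (N\<^sub>\<epsilon> + 1)\<close> for \<open>\<epsilon> \<rightarrow> 0\<close> is an exactly additive
  invariant length \<open>l\<close>, not identically zero, which vanishes on the arcs disjoint from \<open>X\<close>.

  If \<open>l\<close> jumped at an interior point of some arc, in one of the two directions of the arc, by at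
  least \<open>m > 0\<close>, then \<open>T\<close> could be cut open at all such jumps. Every arc contains only finitely
  many of them, so the pieces would form a transverse covering different from \<open>{T}\<close>. Hence \<open>l\<close>
  has no jumps (by minimality every point is interior to an arc), and it integrates to a
  non-atomic measure on every arc.
\<close>

section \<open>Segments in real trees\<close>

text \<open>Segments are encoded by equality in the triangle inequality, so that betweenness becomes
  linear arithmetic and isometries respect it at once. In a real tree this metric interval is the
  geodesic (\<open>geodesic_iff_seg\<close>).\<close>

definition seg :: "'a::metric_space \<Rightarrow> 'a \<Rightarrow> 'a set" where
  "seg x y = {z. dist x z + dist z y = dist x y}"

lemma mem_seg: "z \<in> seg x y \<longleftrightarrow> dist x z + dist z y = dist x y"
  by (simp add: seg_def)

lemma seg_ends [simp]: "x \<in> seg x y" "y \<in> seg x y"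
  by (simp_all add: mem_seg)

lemma seg_commute: "seg x y = seg y x"
  by (auto simp: mem_seg dist_commute)

lemma seg_self [simp]: "seg x x = {x}"
  by (auto simp: mem_seg dist_commute)

lemma seg_antisym:
  assumes "w \<in> seg x y" "y \<in> seg x w"
  shows "w = y"
proof -
  have "dist w y = 0"
    using assms zero_le_dist[of w y] unfolding mem_seg dist_commute[of y w] by linarith
  then show ?thesis by simp
qed

lemma seg_trans:
  assumes "c \<in> seg x y" "w \<in> seg x c"
  shows "w \<in> seg x y" "c \<in> seg w y"
  using assms dist_triangle[of w y c] dist_triangle[of x y w]
  by (simp_all add: mem_seg dist_commute)

lemma seg_trans':
  assumes "c \<in> seg x y" "w \<in> seg c y"
  shows "w \<in> seg x y" "c \<in> seg x w"
  using seg_trans[of c y x w] assms by (simp_all add: seg_commute)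

lemma geodesic_subset_seg:
  assumes "geodesic_segment x y I"
  shows "I \<subseteq> seg x y"
proof
  fix z assume z: "z \<in> I"
  from assms obtain \<gamma> where g: "\<forall>s\<in>{0..dist x y}. \<forall>t\<in>{0..dist x y}. dist (\<gamma> s) (\<gamma> t) = \<bar>s - t\<bar>"
    "\<gamma> 0 = x" "\<gamma> (dist x y) = y" "I = \<gamma> ` {0..dist x y}"
    unfolding geodesic_segment_def by blast
  from z g obtain t where t: "t \<in> {0..dist x y}" "z = \<gamma> t" by blast
  have "dist (\<gamma> 0) (\<gamma> t) = t" "dist (\<gamma> t) (\<gamma> (dist x y)) = dist x y - t"
    using g(1) t(1) by auto
  then show "z \<in> seg x y" using t g by (simp add: mem_seg)
qed

lemma geodesic_arc:
  assumes "geodesic_segment x y I" "x \<noteq> y"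
  obtains p where "arc p" "pathstart p = x" "pathfinish p = y" "path_image p = I"
proof -
  from assms obtain \<gamma> where g: "\<forall>s\<in>{0..dist x y}. \<forall>t\<in>{0..dist x y}. dist (\<gamma> s) (\<gamma> t) = \<bar>s - t\<bar>"
    "\<gamma> 0 = x" "\<gamma> (dist x y) = y" "I = \<gamma> ` {0..dist x y}"
    unfolding geodesic_segment_def by blast
  define L where "L = dist x y"
  have L: "L > 0" using assms by (simp add: L_def)
  have g': "dist (\<gamma> s) (\<gamma> t) = \<bar>s - t\<bar>" if "s \<in> {0..L}" "t \<in> {0..L}" for s t
    using g(1) that unfolding L_def by blast
  have sc: "(\<lambda>t. t * L) ` {0..1} = {0..L}"
    using L by (auto simp: image_iff mult_left_le_one_le intro!: bexI[of _ "_ / L"])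
  have cont: "continuous_on {0..L} \<gamma>"
    unfolding continuous_on_iff using g' by (metis dist_real_def)
  have inj: "inj_on \<gamma> {0..L}"
    by (rule inj_onI) (metis g' dist_self abs_eq_0 eq_iff_diff_eq_0)
  have injL: "inj_on (\<lambda>t. t * L) {0..1}" using L by (auto simp: inj_on_def)
  have "arc (\<lambda>t. \<gamma> (t * L))"
    unfolding arc_def path_def
  proof
    show "continuous_on {0..1} (\<lambda>t. \<gamma> (t * L))"
      by (rule continuous_on_compose2[OF cont]) (use sc in \<open>auto intro!: continuous_intros\<close>)
    show "inj_on (\<lambda>t. \<gamma> (t * L)) {0..1}"
      using comp_inj_on[OF injL] inj sc by (simp add: o_def)
  qed
  moreover have "path_image (\<lambda>t. \<gamma> (t * L)) = I"
  proof -
    have "path_image (\<lambda>t. \<gamma> (t * L)) = \<gamma> ` ((\<lambda>t. t * L) ` {0..1})"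
      by (simp add: path_image_def image_image)
    also have "\<dots> = \<gamma> ` {0..L}" unfolding sc ..
    finally show ?thesis by (simp add: g(4) L_def)
  qed
  ultimately show ?thesis
    using that[of "\<lambda>t. \<gamma> (t * L)"] g by (simp add: pathstart_def pathfinish_def L_def)
qed

lemma geodesic_concat:
  assumes z: "z \<in> seg x y" and I: "geodesic_segment x z I" and J: "geodesic_segment z y J"
  shows "geodesic_segment x y (I \<union> J)"
proof -
  define a b where "a = dist x z" and "b = dist z y"
  have ab: "dist x y = a + b" "0 \<le> a" "0 \<le> b" using z by (auto simp: mem_seg a_def b_def)
  from I obtain f where f: "\<And>s t. s\<in>{0..a} \<Longrightarrow> t\<in>{0..a} \<Longrightarrow> dist (f s) (f t) = \<bar>s - t\<bar>"
    "f 0 = x" "f a = z" "I = f ` {0..a}"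
    unfolding geodesic_segment_def a_def by blast
  from J obtain h where h: "\<And>s t. s\<in>{0..b} \<Longrightarrow> t\<in>{0..b} \<Longrightarrow> dist (h s) (h t) = \<bar>s - t\<bar>"
    "h 0 = z" "h b = y" "J = h ` {0..b}"
    unfolding geodesic_segment_def b_def by blast
  define k where "k t = (if t \<le> a then f t else h (t - a))" for t
  \<comment> \<open>The upper bound goes through z. For the lower bound, a smaller distance would
    make the route from x via \<open>k s\<close> and \<open>k t\<close> to y shorter than
    \<open>dist x y\<close>.\<close>
  have mixed: "dist (k s) (k t) = t - s" if "0 \<le> s" "s \<le> a" "a < t" "t \<le> a + b" for s t
  proof -
    have k: "k s = f s" "k t = h (t - a)" using that by (auto simp: k_def)
    have "dist (f s) (f a) = a - s" "dist (h 0) (h (t - a)) = t - a"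
      "dist (f 0) (f s) = s" "dist (h (t - a)) (h b) = a + b - t"
      using f(1)[of s a] h(1)[of 0 "t - a"] f(1)[of 0 s] h(1)[of "t - a" b] that by auto
    then have "dist (k s) z = a - s" "dist z (k t) = t - a" "dist x (k s) = s" "dist (k t) y = a + b - t"
      using f h k by auto
    then show ?thesis
      using dist_triangle[of "k s" "k t" z] dist_triangle[of x y "k s"] dist_triangle[of "k s" y "k t"] ab
      by linarith
  qed
  have "dist (k s) (k t) = \<bar>s - t\<bar>" if st: "s \<in> {0..a + b}" "t \<in> {0..a + b}" for s t
  proof -
    consider "s \<le> a" "t \<le> a" | "s \<le> a" "a < t" | "a < s" "t \<le> a" | "a < s" "a < t" by linarith
    then show ?thesis
    proof cases
      case 1 then show ?thesis using st f(1) by (auto simp: k_def)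
    next
      case 2 then show ?thesis using mixed[of s t] st by auto
    next
      case 3 then show ?thesis using mixed[of t s] st by (auto simp: dist_commute)
    next
      case 4 then show ?thesis using st h(1)[of "s - a" "t - a"] by (auto simp: k_def)
    qed
  qed
  moreover have "k 0 = x" using f ab by (simp add: k_def)
  moreover have "k (a + b) = y"
    using f h ab by (cases "b = 0") (auto simp: k_def)
  moreover have "k ` {0..a + b} = I \<union> J"
  proof -
    have "k ` {0..a + b} = k ` {0..a} \<union> k ` {a<..a + b}"
      using ab by (metis image_Un ivl_disj_un_two_touch(4) ivl_disj_un_two(8) le_add_same_cancel1)
    also have "k ` {0..a} = I" using f by (auto simp: k_def)
    also have "k ` {a<..a + b} = h ` {0<..b}"
    proof -
      have "k ` {a<..a + b} = (\<lambda>t. h (t - a)) ` {a<..a + b}" by (auto simp: k_def)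
      also have "\<dots> = h ` {0<..b}"
        by (force simp: image_iff intro: bexI[of _ "_ + a"])
      finally show ?thesis .
    qed
    also have "I \<union> h ` {0<..b} = I \<union> J"
    proof -
      have "h 0 \<in> I" using f h ab by force
      moreover have "{0..b} = insert 0 {0<..b}" using ab by auto
      ultimately show ?thesis using h by auto
    qed
    finally show ?thesis .
  qed
  ultimately show ?thesis
    unfolding geodesic_segment_def ab(1) by (intro exI[of _ k]) simp
qed

section \<open>Unique geodesics, the order along a segment, and medians\<close>

locale tree_space =
  fixes T :: "'a::metric_space itself"
  assumes real_tree: "real_tree T"
begin

lemma geodesic_exists: "\<exists>I. geodesic_segment (x::'a) y I"
  using real_tree unfolding real_tree_def by blast

lemma arc_unique:
  fixes p q :: "real \<Rightarrow> 'a"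
  assumes "arc p" "arc q" "pathstart p = pathstart q" "pathfinish p = pathfinish q"
  shows "path_image p = path_image q"
  using real_tree assms unfolding real_tree_def by blast

lemma geodesic_unique:
  fixes x y :: 'a
  assumes "geodesic_segment x y I" "geodesic_segment x y J"
  shows "I = J"
proof (cases "x = y")
  case True
  then show ?thesis using assms by (auto simp: geodesic_segment_def)
next
  case False
  then show ?thesis using arc_unique geodesic_arc assms by metis
qed

text \<open>A point of the metric interval lies on the concatenation of two geodesics through it,
  which is itself a geodesic by \<open>geodesic_concat\<close> and hence the unique one.\<close>

lemma geodesic_iff_seg:
  fixes x y :: 'a
  shows "geodesic_segment x y I \<longleftrightarrow> I = seg x y"
proof -
  obtain I0 where I0: "geodesic_segment x y I0" using geodesic_exists by blast
  have "seg x y \<subseteq> I0"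
  proof
    fix z assume z: "z \<in> seg x y"
    obtain J1 J2 where J: "geodesic_segment x z J1" "geodesic_segment z y J2"
      using geodesic_exists by blast
    then have "geodesic_segment x y (J1 \<union> J2)" using geodesic_concat z by blast
    then have "J1 \<union> J2 = I0" using I0 geodesic_unique by blast
    moreover have "z \<in> J1" using J(1) unfolding geodesic_segment_def
      by (metis atLeastAtMost_iff image_eqI order_refl zero_le_dist)
    ultimately show "z \<in> I0" by blast
  qed
  then have "I0 = seg x y" using geodesic_subset_seg[OF I0] by blast
  then show ?thesis using I0 geodesic_unique by blast
qed

lemma seg_param:
  fixes x y :: 'a
  obtains \<gamma> where "\<And>s t. s\<in>{0..dist x y} \<Longrightarrow> t\<in>{0..dist x y} \<Longrightarrow> dist (\<gamma> s) (\<gamma> t) = \<bar>s - t\<bar>"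
    "\<gamma> 0 = x" "\<gamma> (dist x y) = y" "seg x y = \<gamma> ` {0..dist x y}"
    "\<And>t. t \<in> {0..dist x y} \<Longrightarrow> dist x (\<gamma> t) = t"
    "continuous_on {0..dist x y} \<gamma>"
proof -
  have "geodesic_segment x y (seg x y)" using geodesic_iff_seg by blast
  then obtain \<gamma> where g: "\<And>s t. s\<in>{0..dist x y} \<Longrightarrow> t\<in>{0..dist x y} \<Longrightarrow> dist (\<gamma> s) (\<gamma> t) = \<bar>s - t\<bar>"
    "\<gamma> 0 = x" "\<gamma> (dist x y) = y" "seg x y = \<gamma> ` {0..dist x y}"
    unfolding geodesic_segment_def by blast
  moreover have "dist x (\<gamma> t) = t" if "t \<in> {0..dist x y}" for t
    using g(1)[of 0 t] g(2) that by auto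
  moreover have "continuous_on {0..dist x y} \<gamma>"
    unfolding continuous_on_iff using g(1) by (metis dist_real_def)
  ultimately show ?thesis using that by blast
qed

lemma compact_seg: "compact (seg (x::'a) y)"
  by (rule seg_param[of x y]) (metis compact_Icc compact_continuous_image)

lemma connected_seg: "connected (seg (x::'a) y)"
  by (rule seg_param[of x y]) (metis connected_Icc connected_continuous_image)

lemma dist_on_seg:
  assumes "a \<in> seg (x::'a) y" "b \<in> seg x y"
  shows "dist a b = \<bar>dist x a - dist x b\<bar>"
  by (rule seg_param[of x y]) (use assms in \<open>metis imageE\<close>)

lemma seg_linear:
  assumes "a \<in> seg (x::'a) y" "b \<in> seg x y" "dist x a \<le> dist x b"
  shows "a \<in> seg x b" "b \<in> seg a y"
  using dist_on_seg[OF assms(1,2)] assms by (auto simp: mem_seg)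

lemma seg_cases:
  assumes "a \<in> seg (x::'a) y" "b \<in> seg x y"
  obtains "a \<in> seg x b" "b \<in> seg a y" | "b \<in> seg x a" "a \<in> seg b y"
  using seg_linear[OF assms] seg_linear[OF assms(2,1)] by linarith

lemma seg_split:
  assumes "c \<in> seg (x::'a) y"
  shows "seg x y = seg x c \<union> seg c y"
proof (intro equalityI subsetI)
  fix w assume "w \<in> seg x y"
  from seg_cases[OF this assms] show "w \<in> seg x c \<union> seg c y" by cases auto
next
  fix w assume "w \<in> seg x c \<union> seg c y"
  then show "w \<in> seg x y"
    using seg_trans(1)[OF assms, of w] seg_trans'(1)[OF assms, of w] by blast
qed

lemma seg_convex:
  assumes "a \<in> seg (x::'a) y" "b \<in> seg x y"
  shows "seg a b \<subseteq> seg x y"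
proof
  fix w assume w: "w \<in> seg a b"
  from seg_cases[OF assms] show "w \<in> seg x y"
  proof cases
    case 1
    then have "w \<in> seg x b" using w seg_trans'(1)[of a x b w] by simp
    then show ?thesis using assms seg_trans(1) by blast
  next
    case 2
    then have "w \<in> seg x a" using w seg_trans'(1)[of b x a w] by (simp add: seg_commute)
    then show ?thesis using assms seg_trans(1) by blast
  qed
qed

text \<open>Take c farthest from x on the common part of the segments to y and z. Then
  \<open>seg y c\<close> and \<open>seg c z\<close> meet only in c, so they join to an arc, and
  uniqueness of arcs makes its image \<open>seg y z\<close>.\<close>

lemma median_exists:
  fixes x y z :: 'a
  obtains c where "c \<in> seg x y" "c \<in> seg x z" "c \<in> seg y z"
proof -
  have "compact (seg x y \<inter> seg x z)" by (intro compact_Int compact_seg)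
  moreover have "seg x y \<inter> seg x z \<noteq> {}" using seg_ends by blast
  moreover have "continuous_on (seg x y \<inter> seg x z) (dist x)" by (intro continuous_intros)
  ultimately obtain c where c: "c \<in> seg x y" "c \<in> seg x z"
    and mx: "\<And>w. w \<in> seg x y \<Longrightarrow> w \<in> seg x z \<Longrightarrow> dist x w \<le> dist x c"
    using continuous_attains_sup[of "seg x y \<inter> seg x z" "dist x"] by blast
  have meet: "seg y c \<inter> seg c z \<subseteq> {c}"
  proof
    fix w assume w: "w \<in> seg y c \<inter> seg c z"
    then have "w \<in> seg x y" "w \<in> seg x z" "c \<in> seg x w"
      using c seg_trans'[of c x y w] seg_trans'[of c x z w] by (auto simp: seg_commute)
    then have "dist c w \<le> 0" using mx[of w] unfolding mem_seg by linarith
    then show "w \<in> {c}" by simp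
  qed
  show ?thesis
  proof (cases "c = y \<or> c = z")
    case True
    then show ?thesis using that[OF c] by auto
  next
    case False
    obtain p where p: "arc p" "pathstart p = y" "pathfinish p = c" "path_image p = seg y c"
      using geodesic_arc[of y c "seg y c"] geodesic_iff_seg False by metis
    obtain q where q: "arc q" "pathstart q = c" "pathfinish q = z" "path_image q = seg c z"
      using geodesic_arc[of c z "seg c z"] geodesic_iff_seg False by metis
    have "y \<noteq> z" using meet False by (metis IntI seg_ends(1,2) singletonD subsetD)
    then obtain r where r: "arc r" "pathstart r = y" "pathfinish r = z" "path_image r = seg y z"
      using geodesic_arc[of y z "seg y z"] geodesic_iff_seg by metis
    have pq: "arc (p +++ q)" using p q meet by (intro arc_join) auto
    have "path_image (p +++ q) = path_image r"
      by (rule arc_unique) (use pq r p q in auto)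
    moreover have "path_image (p +++ q) = seg y c \<union> seg c z"
      using p q by (simp add: path_image_join)
    ultimately have "c \<in> seg y z" using r seg_ends by blast
    then show ?thesis using that c by blast
  qed
qed

text \<open>Covers the part of a segment near its end z by a segment, whose measure will be given by
  a length; \<open>w'\<close> is the point at distance \<open>min r (dist z w)\<close> from
  z.\<close>

lemma seg_truncate:
  assumes "r \<ge> 0"
  obtains w' where "w' \<in> seg (z::'a) w" "ball z r \<inter> seg z w \<subseteq> seg z w'" "dist z w' \<le> r"
proof -
  obtain \<gamma> where g: "seg z w = \<gamma> ` {0..dist z w}"
    "\<And>t. t \<in> {0..dist z w} \<Longrightarrow> dist z (\<gamma> t) = t"
    by (rule seg_param[of z w]) blast
  define w' where "w' = \<gamma> (min r (dist z w))"
  have w': "w' \<in> seg z w" "dist z w' = min r (dist z w)" using g assms by (auto simp: w'_def)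
  have "y \<in> seg z w'" if "y \<in> seg z w" "dist z y < r" for y
    using seg_linear(1)[OF that(1) w'(1)] w'(2) that g by auto
  then have "ball z r \<inter> seg z w \<subseteq> seg z w'" by auto
  then show ?thesis using that[of w'] w' by simp
qed

lemma connected_if_seg_subset:
  assumes "u \<in> S" "\<And>a. a \<in> S \<Longrightarrow> seg (u::'a) a \<subseteq> S"
  shows "connected S"
proof -
  have "S = \<Union> (seg u ` S)" using assms by fastforce
  moreover have "connected (\<Union> (seg u ` S))"
  proof (rule connected_Union)
    have "u \<in> \<Inter> (seg u ` S)" by simp
    then show "\<Inter> (seg u ` S) \<noteq> {}" by blast
  qed (auto simp: connected_seg)
  ultimately show ?thesis by simp
qed

text \<open>Cut \<open>seg p q\<close> at the median: each half is part of one of the other two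
  sides of the triangle.\<close>

lemma seg_subset_Un: "seg (p::'a) q \<subseteq> seg p r \<union> seg r q"
proof
  fix w assume w: "w \<in> seg p q"
  obtain c where c: "c \<in> seg p q" "c \<in> seg p r" "c \<in> seg q r" by (rule median_exists)
  from seg_cases[OF w c(1)] show "w \<in> seg p r \<union> seg r q"
    using c seg_trans(1)[OF c(2)] seg_trans'(1)[of c r q w] by (auto simp: seg_commute)
qed

text \<open>The median of y, a, b serves as c. It witnesses that a and b lie in the same direction
  from y: the two segments from y share an initial piece.\<close>

lemma same_direction:
  assumes "y \<notin> seg (a::'a) b"
  obtains c where "c \<in> seg y a" "c \<in> seg y b" "c \<noteq> y"
  using median_exists[of y a b] assms by metis

end

section \<open>Additive lengths and the transverse covering cut out by their jumps\<close>

locale length_function = tree_space T for T :: "'a::metric_space itself" +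
  fixes l :: "'a \<Rightarrow> 'a \<Rightarrow> real"
  assumes l_nonneg: "0 \<le> l x y"
    and l_commute: "l x y = l y x"
    and l_add: "z \<in> seg x y \<Longrightarrow> l x y = l x z + l z y"
begin

lemma l_self [simp]: "l x x = 0"
  using l_add[of x x x] by simp

lemma l_mono: "z \<in> seg x y \<Longrightarrow> l x z \<le> l x y"
  using l_add[of z x y] l_nonneg[of z y] by simp

text \<open>\<open>l\<close> has a jump of at least \<open>m\<close> at \<open>y\<close> in the direction of \<open>z\<close>; by \<open>jumps_direction\<close> below
  this depends only on the component of \<open>z\<close> in the complement of \<open>y\<close>.\<close>

definition jumps :: "real \<Rightarrow> 'a \<Rightarrow> 'a \<Rightarrow> bool" where
  "jumps m y z \<longleftrightarrow> z \<noteq> y \<and> (\<forall>w\<in>seg y z - {y}. m \<le> l y w)"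

text \<open>The ends of the segment do not count, so a point with a jump still belongs to the pieces
  next to it; this keeps the pieces closed and lets neighbours share that point.\<close>

definition cut_point :: "real \<Rightarrow> 'a \<Rightarrow> 'a \<Rightarrow> 'a \<Rightarrow> bool" where
  "cut_point m u q y \<longleftrightarrow> y \<in> seg u q \<and> y \<noteq> u \<and> y \<noteq> q \<and> (jumps m y u \<or> jumps m y q)"

definition uncut :: "real \<Rightarrow> 'a \<Rightarrow> 'a \<Rightarrow> bool" where
  "uncut m u q \<longleftrightarrow> (\<forall>y. \<not> cut_point m u q y)"

text \<open>One base point would not do: two points uncut from u can still be separated by u itself.
  With a second base point v different from u this cannot happen
  (\<open>uncut_via_two\<close>).\<close>

definition piece :: "real \<Rightarrow> 'a \<Rightarrow> 'a \<Rightarrow> 'a set" where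
  "piece m u v = {q. uncut m u q \<and> uncut m v q}"

lemma cut_point_commute: "cut_point m u q y \<longleftrightarrow> cut_point m q u y"
  unfolding cut_point_def by (metis seg_commute)

lemma uncut_commute: "uncut m u q \<longleftrightarrow> uncut m q u"
  unfolding uncut_def using cut_point_commute by blast

lemma uncut_self [simp]: "uncut m u u"
  by (auto simp: uncut_def cut_point_def)

text \<open>Both segments from y run together up to some c. Before c the bound is the one towards z,
  and beyond c it persists because \<open>l\<close> is monotone along segments.\<close>

lemma jumps_direction:
  assumes "jumps m y z" "y \<notin> seg z z'"
  shows "jumps m y z'"
proof -
  obtain c where c: "c \<in> seg y z" "c \<in> seg y z'" "c \<noteq> y"
    using same_direction assms(2) by blast
  have "m \<le> l y w" if w: "w \<in> seg y z'" "w \<noteq> y" for w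
    using w(1) c(2)
  proof (cases rule: seg_cases)
    case 1
    then have "w \<in> seg y z" using seg_trans(1) c(1) by blast
    then show ?thesis using assms(1) w by (auto simp: jumps_def)
  next
    case 2
    have "m \<le> l y c" using assms(1) c by (auto simp: jumps_def)
    then show ?thesis using l_mono[OF 2(1)] by linarith
  qed
  moreover have "z' \<noteq> y" using assms(2) by auto
  ultimately show ?thesis by (auto simp: jumps_def)
qed

lemma seg_no_return:
  assumes "a \<in> seg u b" "y \<in> seg a b" "y \<noteq> a"
  shows "y \<notin> seg a u"
proof
  assume "y \<in> seg a u"
  then have "y \<in> seg u a" by (simp add: seg_commute)
  then have "a \<in> seg y b" using seg_trans(2)[OF assms(1)] by blast
  then show False using seg_antisym[of y b a] assms(2,3) by (simp add: seg_commute)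
qed

text \<open>Order the points as u, a, b, q. Seen from y, a and u lie in the same direction, and so
  do b and q; hence \<open>jumps_direction\<close> carries the jump over to the longer
  segment.\<close>

lemma cut_point_extend:
  assumes ab: "a \<in> seg u q" "b \<in> seg u q" and y: "cut_point m a b y"
  shows "cut_point m u q y"
proof -
  have aux: "cut_point m u q y"
    if ab: "a \<in> seg u q" "b \<in> seg u q" "a \<in> seg u b" "b \<in> seg a q" and y: "cut_point m a b y" for a b
  proof -
    have "y \<notin> seg a u" using seg_no_return[of a u b y] that by (auto simp: cut_point_def)
    moreover have "y \<notin> seg b q"
      using seg_no_return[of b q a y] that by (auto simp: cut_point_def seg_commute)
    moreover have "y \<in> seg u q" using y seg_convex[OF ab(1,2)] by (auto simp: cut_point_def)
    ultimately show ?thesis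
      using y jumps_direction[of m y a u] jumps_direction[of m y b q]
      by (auto simp: cut_point_def)
  qed
  show ?thesis
    using ab
  proof (cases rule: seg_cases)
    case 1 then show ?thesis using aux ab y by blast
  next
    case 2 then show ?thesis using aux[of b a] ab y cut_point_commute by blast
  qed
qed

text \<open>Suppose y differs from z and \<open>l\<close> jumps at y towards b. If y is on
  \<open>seg z b\<close>, it cuts z from b. Otherwise it is on \<open>seg z a\<close>, z lies in the
  direction of b, and y cuts z from a.\<close>

lemma cut_point_via:
  assumes "uncut m z a" "uncut m z b" "cut_point m a b y"
  shows "y = z"
proof (rule ccontr)
  assume yz: "y \<noteq> z"
  have aux: False if "uncut m z a" "uncut m z b" "cut_point m a b y" "jumps m y b" for a b
  proof (cases "y \<in> seg z b")
    case True
    then show False using that yz by (auto simp: uncut_def cut_point_def)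
  next
    case False
    then have "y \<in> seg z a"
      using that(3) seg_subset_Un[of a b z] by (auto simp: cut_point_def seg_commute)
    moreover have "jumps m y z" using jumps_direction[OF that(4)] False by (simp add: seg_commute)
    ultimately show False using that yz by (auto simp: uncut_def cut_point_def)
  qed
  from assms(3) have "jumps m y a \<or> jumps m y b" by (simp add: cut_point_def)
  then show False using aux[of a b] aux[of b a] assms cut_point_commute by blast
qed

text \<open>By \<open>cut_point_via\<close> a cut point between a and b would equal both u and
  v.\<close>

lemma uncut_via_two:
  assumes "u \<noteq> v" "uncut m u a" "uncut m v a" "uncut m u b" "uncut m v b"
  shows "uncut m a b"
  using assms cut_point_via unfolding uncut_def[of m a b] by blast

lemma piece_uncut:
  assumes "u \<noteq> v" "a \<in> piece m u v" "b \<in> piece m u v"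
  shows "uncut m a b"
  using assms uncut_via_two by (auto simp: piece_def)

lemma piece_ends:
  assumes "uncut m u v"
  shows "u \<in> piece m u v" "v \<in> piece m u v"
  using assms by (auto simp: piece_def uncut_commute)

text \<open>All points of a piece are mutually uncut, so either pair of base points can replace the
  other. This is the source of transversality: two pieces with two common points coincide.\<close>

lemma piece_eq:
  assumes "u \<noteq> v" "uncut m u v" "a \<noteq> b" "a \<in> piece m u v" "b \<in> piece m u v"
  shows "piece m a b = piece m u v"
proof
  show "piece m u v \<subseteq> piece m a b"
    using piece_uncut[OF assms(1,4)] piece_uncut[OF assms(1,5)] by (auto simp: piece_def)
  have uv: "u \<in> piece m a b" "v \<in> piece m a b"
    using assms(4,5) by (auto simp: piece_def uncut_commute)
  then show "piece m a b \<subseteq> piece m u v"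
    using piece_uncut[OF assms(3) uv(1)] piece_uncut[OF assms(3) uv(2)] by (auto simp: piece_def)
qed

lemma uncut_subseg:
  assumes "uncut m u q" "a \<in> seg u q" "b \<in> seg u q"
  shows "uncut m a b"
  using assms cut_point_extend unfolding uncut_def by blast

lemma seg_subset_piece:
  assumes "uncut m u q"
  shows "seg u q \<subseteq> piece m u q"
  using uncut_subseg[OF assms] by (auto simp: piece_def)

lemma piece_convex:
  assumes "u \<noteq> v" "uncut m u v" "a \<in> piece m u v" "b \<in> piece m u v"
  shows "seg a b \<subseteq> piece m u v"
proof (cases "a = b")
  case True
  then show ?thesis using assms by simp
next
  case False
  then show ?thesis
    using seg_subset_piece[of m a b] piece_eq[OF assms(1,2) False assms(3,4)]
      piece_uncut[OF assms(1,3,4)] by simp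
qed

text \<open>The complement is open: a cut point y between u and q also cuts u from every
  \<open>q'\<close> closer to q than y is, since \<open>q'\<close> then lies in the same direction
  from y as q.\<close>

lemma closed_uncut: "closed {q. uncut m u q}"
proof -
  have "open (- {q. uncut m u q})"
    unfolding open_dist
  proof
    fix q assume "q \<in> - {q. uncut m u q}"
    then obtain y where y: "y \<in> seg u q" "y \<noteq> u" "y \<noteq> q" "jumps m y u \<or> jumps m y q"
      by (auto simp: uncut_def cut_point_def)
    have "cut_point m u q' y" if d: "dist q' q < dist y q" for q'
    proof -
      have n: "y \<notin> seg q q'"
        using d zero_le_dist[of y q'] unfolding mem_seg dist_commute[of q] by linarith
      then have "y \<notin> seg q' q" by (simp add: seg_commute)
      then have "y \<in> seg u q'" using y(1) seg_subset_Un[of u q q'] by blast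
      then show ?thesis using y d n jumps_direction[of m y q q'] by (auto simp: cut_point_def)
    qed
    then show "\<exists>e>0. \<forall>q'. dist q' q < e \<longrightarrow> q' \<in> - {q. uncut m u q}"
      using y(3) by (intro exI[of _ "dist y q"]) (auto simp: uncut_def)
  qed
  then show ?thesis by (simp add: closed_def)
qed

lemma closed_piece: "closed (piece m u v)"
  using closed_Int[OF closed_uncut closed_uncut] by (simp add: piece_def Collect_conj_eq)

text \<open>The points are added in order of distance from u. The jump at the new point y towards u
  makes \<open>l\<close> grow by at least m between the preceding point \<open>y'\<close> and
  y.\<close>

lemma card_jumps_le:
  assumes "finite B"
  shows "B \<subseteq> seg u q \<Longrightarrow> \<forall>y\<in>B. jumps m y u \<Longrightarrow> real (card B) * m \<le> l u q"
  using assms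
proof (induction B arbitrary: q rule: finite_ranking_induct[where f = "dist u"])
  case empty
  then show ?case by (simp add: l_nonneg)
next
  case (insert y S)
  show ?case
  proof (cases "y \<in> S")
    case True
    then show ?thesis using insert by (simp add: insert_absorb)
  next
    case False
    have y: "y \<in> seg u q" "jumps m y u" using insert.prems by auto
    have step: "l u y' + m \<le> l u q" if "y' \<in> seg u y" "y' \<noteq> y" for y'
    proof -
      have "m \<le> l y y'" using y(2) that by (auto simp: jumps_def seg_commute)
      then show ?thesis using l_add[OF that(1)] l_mono[OF y(1)] l_commute[of y y'] by linarith
    qed
    have S: "z \<in> seg u y" if "z \<in> S" for z
      using seg_linear(1)[of z u q y] insert.prems insert.hyps(2)[OF that] that by auto
    show ?thesis
    proof (cases "S = {}")
      case True
      \<comment> \<open>For the first jump point, u itself serves as the predecessor.\<close>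
      then show ?thesis using step[of u] y(2) by (auto simp: jumps_def)
    next
      case False
      have "Max (dist u ` S) \<in> dist u ` S" using insert.hyps(1) False by simp
      then obtain y' where y': "y' \<in> S" "dist u y' = Max (dist u ` S)" by auto
      have "dist u z \<le> dist u y'" if "z \<in> S" for z
        using insert.hyps(1) that y'(2) by simp
      then have "S \<subseteq> seg u y'" using seg_linear(1)[of _ u y y'] S y' by blast
      then have "real (card S) * m \<le> l u y'" using insert by auto
      moreover have "y' \<noteq> y" using y' \<open>y \<notin> S\<close> by blast
      ultimately show ?thesis
        using step[of y'] S[OF y'(1)] insert.hyps(1) \<open>y \<notin> S\<close> by (simp add: algebra_simps)
    qed
  qed
qed

lemma finite_jumps:
  assumes "m > 0"
  shows "finite {y \<in> seg u q. jumps m y u}"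
proof (rule ccontr)
  assume inf: "infinite {y \<in> seg u q. jumps m y u}"
  define n where "n = nat \<lceil>l u q / m\<rceil> + 1"
  obtain B where B: "finite B" "card B = n" "B \<subseteq> {y \<in> seg u q. jumps m y u}"
    using infinite_arbitrarily_large[OF inf] by blast
  then have "real n * m \<le> l u q" using card_jumps_le[of B u q m] by blast
  then have "real n \<le> l u q / m" using assms by (simp add: pos_le_divide_eq)
  then show False unfolding n_def by linarith
qed

lemma finite_cut_points:
  assumes "m > 0"
  shows "finite {y. cut_point m u q y}"
proof (rule finite_subset)
  show "{y. cut_point m u q y} \<subseteq> {y \<in> seg u q. jumps m y u} \<union> {y \<in> seg q u. jumps m y q}"
    by (auto simp: cut_point_def seg_commute)
qed (simp add: finite_jumps[OF assms])

definition pieces :: "real \<Rightarrow> 'a set set" where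
  "pieces m = {piece m u v | u v. u \<noteq> v \<and> uncut m u v}"

text \<open>Induction on the number of cut points, finite by \<open>finite_cut_points\<close>:
  splitting at a cut point y leaves fewer of them on both halves, since y is an end of each.\<close>

lemma seg_covered:
  assumes m: "m > 0" and "u \<noteq> q"
  shows "\<exists>\<F>\<subseteq>pieces m. finite \<F> \<and> seg u q \<subseteq> \<Union>\<F>"
  using \<open>u \<noteq> q\<close>
proof (induction "card {y. cut_point m u q y}" arbitrary: u q rule: less_induct)
  case less
  show ?case
  proof (cases "uncut m u q")
    case True
    then show ?thesis
      using seg_subset_piece[OF True] less.prems
      by (intro exI[of _ "{piece m u q}"]) (auto simp: pieces_def)
  next
    case False
    then obtain y where y: "cut_point m u q y" by (auto simp: uncut_def)
    then have ys: "y \<in> seg u q" "y \<noteq> u" "y \<noteq> q" by (auto simp: cut_point_def)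
    have "\<not> cut_point m u y y" "\<not> cut_point m y q y" by (auto simp: cut_point_def)
    then have "{z. cut_point m u y z} \<subset> {z. cut_point m u q z}"
      "{z. cut_point m y q z} \<subset> {z. cut_point m u q z}"
      using cut_point_extend[OF _ ys(1), of u] cut_point_extend[OF ys(1), of q] y
      by (auto simp: psubset_eq set_eq_iff simp del: not_all)
    then have "card {z. cut_point m u y z} < card {z. cut_point m u q z}"
      "card {z. cut_point m y q z} < card {z. cut_point m u q z}"
      using finite_cut_points[OF m] by (auto intro: psubset_card_mono)
    from less.hyps[OF this(1)] less.hyps[OF this(2)] ys obtain F1 F2 where
      "F1 \<subseteq> pieces m" "finite F1" "seg u y \<subseteq> \<Union>F1"
      "F2 \<subseteq> pieces m" "finite F2" "seg y q \<subseteq> \<Union>F2" by metis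
    then show ?thesis
      using seg_split[OF ys(1)] by (intro exI[of _ "F1 \<union> F2"]) auto
  qed
qed

end

section \<open>Isometric actions and minimality\<close>

locale tree_action = tree_space T for T :: "'a::metric_space itself" +
  fixes G :: "('g, 'm) monoid_scheme" (structure) and \<phi> :: "'g \<Rightarrow> 'a \<Rightarrow> 'a"
  assumes isometric: "isometric_action G \<phi>"
begin

sublocale group_action G "UNIV :: 'a set" \<phi>
  using isometric by (simp add: isometric_action_def)

lemma group_G: "group G"
  using group_hom group_hom.axioms(1) by blast

lemma dist_act: "g \<in> carrier G \<Longrightarrow> dist (\<phi> g x) (\<phi> g y) = dist x y"
  using isometric by (simp add: isometric_action_def)

lemma act_one [simp]: "\<phi> \<one> x = x"
  using id_eq_one by (metis UNIV_I restrict_apply)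

lemma act_mult: "g \<in> carrier G \<Longrightarrow> h \<in> carrier G \<Longrightarrow> \<phi> (g \<otimes> h) x = \<phi> g (\<phi> h x)"
  using composition_rule by blast

lemma act_inv_left [simp]: "g \<in> carrier G \<Longrightarrow> \<phi> (inv g) (\<phi> g x) = x"
  using act_mult[of "inv g" g x] group.l_inv[OF group_G] group.inv_closed[OF group_G] by simp

lemma act_inv_right [simp]: "g \<in> carrier G \<Longrightarrow> \<phi> g (\<phi> (inv g) x) = x"
  using act_mult[of g "inv g" x] group.r_inv[OF group_G] group.inv_closed[OF group_G] by simp

lemma act_eq_iff [simp]: "g \<in> carrier G \<Longrightarrow> \<phi> g x = \<phi> g y \<longleftrightarrow> x = y"
  using dist_act[of g x y] by (metis dist_eq_0_iff)

lemma mem_seg_act [simp]: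
  "g \<in> carrier G \<Longrightarrow> \<phi> g z \<in> seg (\<phi> g x) (\<phi> g y) \<longleftrightarrow> z \<in> seg x y"
  by (simp add: mem_seg dist_act)

lemma act_imageI:
  assumes "g \<in> carrier G" "\<And>z. z \<in> A \<longleftrightarrow> \<phi> g z \<in> B"
  shows "\<phi> g ` A = B"
proof
  show "B \<subseteq> \<phi> g ` A"
  proof
    fix b assume "b \<in> B"
    then have "\<phi> (inv g) b \<in> A" using assms by simp
    then show "b \<in> \<phi> g ` A" using assms(1) by (metis act_inv_right imageI)
  qed
qed (use assms in auto)

lemma act_seg: "g \<in> carrier G \<Longrightarrow> \<phi> g ` seg x y = seg (\<phi> g x) (\<phi> g y)"
  by (rule act_imageI) auto

text \<open>The set of points interior to some segment contains the midpoint of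
  \<open>seg a b\<close>, is invariant, and contains with any two points the segment between them.
  Minimality makes it the whole tree.\<close>

lemma every_point_interior:
  assumes min: "minimal_action G \<phi>" and ab: "(a::'a) \<noteq> b"
  obtains u v where "(y::'a) \<in> seg u v" "y \<noteq> u" "y \<noteq> v"
proof -
  define S where "S = {y::'a. \<exists>u v. y \<in> seg u v \<and> y \<noteq> u \<and> y \<noteq> v}"
  have "\<exists>z. z \<in> S"
  proof -
    obtain \<gamma> where g: "seg a b = \<gamma> ` {0..dist a b}" "\<And>t. t \<in> {0..dist a b} \<Longrightarrow> dist a (\<gamma> t) = t"
      by (rule seg_param[of a b]) blast
    let ?z = "\<gamma> (dist a b / 2)"
    have "?z \<in> seg a b" "dist a ?z = dist a b / 2" using g by auto
    then show ?thesis using ab unfolding S_def by force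
  qed
  then obtain z where z: "z \<in> S" by blast
  have "seg z y \<subseteq> S" if "y \<in> S" for y using z that unfolding S_def by blast
  then have "connected S" using connected_if_seg_subset[OF z] by simp
  then have "subtree S" using z by (auto simp: subtree_def)
  moreover have "invariant_set G \<phi> S"
    unfolding invariant_set_def
  proof (intro ballI act_imageI)
    fix g y assume g: "g \<in> carrier G"
    show "y \<in> S \<longleftrightarrow> \<phi> g y \<in> S"
    proof
      assume "y \<in> S"
      then show "\<phi> g y \<in> S" unfolding S_def using mem_seg_act[OF g] act_eq_iff[OF g] by blast
    next
      assume "\<phi> g y \<in> S"
      then obtain u v where uv: "\<phi> g y \<in> seg u v" "\<phi> g y \<noteq> u" "\<phi> g y \<noteq> v" unfolding S_def by blast
      then have "y \<in> seg (\<phi> (inv g) u) (\<phi> (inv g) v)"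
        using mem_seg_act[OF g, of y "\<phi> (inv g) u" "\<phi> (inv g) v"] g by simp
      moreover have "y \<noteq> \<phi> (inv g) u" "y \<noteq> \<phi> (inv g) v" using uv g by auto
      ultimately show "y \<in> S" unfolding S_def by blast
    qed
  qed
  ultimately have "S = UNIV" using min by (auto simp: minimal_action_def)
  then have "y \<in> S" by simp
  then obtain u v where "y \<in> seg u v" "y \<noteq> u" "y \<noteq> v" unfolding S_def by auto
  then show ?thesis by (rule that)
qed

end

section \<open>Invariance of the pieces and absence of jumps\<close>

locale invariant_length = tree_action T G \<phi> + length_function T l
  for T :: "'a::metric_space itself" and G :: "('g, 'm) monoid_scheme" (structure) and \<phi> l +
  assumes l_act: "g \<in> carrier G \<Longrightarrow> l (\<phi> g x) (\<phi> g y) = l x y"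
begin

lemma jumps_act:
  assumes g: "g \<in> carrier G" and "jumps m y z"
  shows "jumps m (\<phi> g y) (\<phi> g z)"
  unfolding jumps_def
proof (intro conjI ballI)
  show "\<phi> g z \<noteq> \<phi> g y" using assms by (simp add: jumps_def)
  fix w assume w: "w \<in> seg (\<phi> g y) (\<phi> g z) - {\<phi> g y}"
  then obtain w' where w': "w' \<in> seg y z" "w = \<phi> g w'" using act_seg[OF g] by blast
  then have "w' \<noteq> y" using w by auto
  then show "m \<le> l (\<phi> g y) w" using w' assms l_act[OF g] by (auto simp: jumps_def)
qed

lemma cut_point_act:
  assumes g: "g \<in> carrier G" and "cut_point m u q y"
  shows "cut_point m (\<phi> g u) (\<phi> g q) (\<phi> g y)"
  using assms jumps_act[OF g] by (auto simp: cut_point_def)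

lemma uncut_act [simp]:
  assumes g: "g \<in> carrier G"
  shows "uncut m (\<phi> g u) (\<phi> g q) \<longleftrightarrow> uncut m u q"
proof -
  have "cut_point m u q (\<phi> (inv g) y)" if "cut_point m (\<phi> g u) (\<phi> g q) y" for y
    using cut_point_act[OF _ that, of "inv g"] g group.inv_closed[OF group_G] by simp
  then show ?thesis using cut_point_act[OF g] unfolding uncut_def by blast
qed

lemma piece_act:
  assumes "g \<in> carrier G"
  shows "\<phi> g ` piece m u v = piece m (\<phi> g u) (\<phi> g v)"
  by (rule act_imageI) (use assms in \<open>auto simp: piece_def\<close>)

lemma transverse_covering_pieces:
  assumes m: "m > 0" and ab: "(a::'a) \<noteq> b"
  shows "transverse_covering G \<phi> (pieces m)"
  unfolding transverse_covering_def
proof (intro conjI ballI allI impI)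
  fix Y assume "Y \<in> pieces m"
  then obtain u v where Y: "Y = piece m u v" "u \<noteq> v" "uncut m u v" by (auto simp: pieces_def)
  have uv: "u \<in> Y" "v \<in> Y" using piece_ends[OF Y(3)] Y(1) by auto
  show "closed Y" using closed_piece Y by simp
  show "nondegenerate Y" using uv Y by (auto simp: nondegenerate_def)
  show "subtree Y"
    using uv connected_if_seg_subset[of u Y] piece_convex[OF Y(2,3)] Y(1)
    by (auto simp: subtree_def)
  fix g assume g: "g \<in> carrier G"
  then show "\<phi> g ` Y \<in> pieces m"
    using Y act_eq_iff[OF g, of u v] uncut_act[OF g, of m u v] unfolding pieces_def piece_act[OF g] Y(1)
    by blast
next
  fix Y Z x y assume Y: "Y \<in> pieces m" and Z: "Z \<in> pieces m" and "Y \<noteq> Z"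
    and "x \<in> Y \<inter> Z" "y \<in> Y \<inter> Z"
  then show "x = y" using piece_eq unfolding pieces_def by (smt (verit) IntE mem_Collect_eq)
next
  fix I :: "'a set" assume "finite_arc I"
  then obtain x y where I: "I = seg x y" by (auto simp: finite_arc_def geodesic_iff_seg)
  \<comment> \<open>Pieces are spanned by two distinct points, so a one-point arc is first enlarged
    to a segment.\<close>
  obtain z where "z \<noteq> x" using ab by metis
  show "\<exists>\<F>\<subseteq>pieces m. finite \<F> \<and> I \<subseteq> \<Union> \<F>"
  proof (cases "x = y")
    case True
    then have "I \<subseteq> seg x z" using I by simp
    moreover have "\<exists>\<F>\<subseteq>pieces m. finite \<F> \<and> seg x z \<subseteq> \<Union>\<F>"
      using seg_covered[OF m] \<open>z \<noteq> x\<close> by metis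
    ultimately show ?thesis by (meson subset_trans)
  next
    case False
    then show ?thesis using seg_covered[OF m] I by blast
  qed
qed

text \<open>The covering by pieces must be the trivial one, so the tree itself is a piece, and
  points of one piece are mutually uncut.\<close>

lemma uncut_if_no_splitting:
  assumes "\<not> splits_as_graph_of_actions G \<phi>" "m > 0" "(a::'a) \<noteq> b"
  shows "uncut m x y"
proof -
  have "pieces m = {UNIV}"
    using transverse_covering_pieces[OF assms(2,3)] assms(1)
    unfolding splits_as_graph_of_actions_def by blast
  then obtain u v where "UNIV = piece m u v" "u \<noteq> v" unfolding pieces_def by blast
  then show ?thesis using piece_uncut[of u v x m y] by blast
qed

text \<open>The point y is interior to some \<open>seg u v\<close>, so it lies on
  \<open>seg z u\<close> or on \<open>seg z v\<close>. A jump at y towards z would make y a cut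
  point of that segment.\<close>

lemma small_length:
  assumes "\<not> splits_as_graph_of_actions G \<phi>" "minimal_action G \<phi>" "m > 0" "z \<noteq> y"
  obtains w where "w \<in> seg y z" "w \<noteq> y" "l y w < m"
proof -
  obtain u v where uv: "y \<in> seg u v" "y \<noteq> u" "y \<noteq> v"
    using every_point_interior[OF assms(2,4)] .
  have aux: "\<not> jumps m y u" "\<not> jumps m y v"
    using uncut_if_no_splitting[OF assms(1,3,4), of u v] uv by (auto simp: uncut_def cut_point_def)
  have "y \<in> seg z u \<or> y \<in> seg z v"
    using seg_subset_Un[of u v z] uv(1) by (auto simp: seg_commute)
  then have "\<not> jumps m y z"
    using uncut_if_no_splitting[OF assms(1,3,4)] uv assms(4)
    unfolding uncut_def cut_point_def by metis
  then show ?thesis using that assms(4) unfolding jumps_def by fastforce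
qed

end

section \<open>The length measure of a continuous additive length\<close>

text \<open>One small value in each direction is enough: monotonicity spreads it over an initial
  piece of the segment, so \<open>l\<close> is continuous along segments.\<close>

locale continuous_length = length_function T l for T :: "'a::metric_space itself" and l +
  assumes l_small: "z \<noteq> y \<Longrightarrow> m > 0 \<Longrightarrow> \<exists>w\<in>seg y z - {y}. l y w < m"
begin

text \<open>A characterization by the values on subsegments. With uniqueness
  (\<open>arc_measure_eqI\<close>) it gives compatibility with restriction and invariance without
  going back to the construction.\<close>

definition arc_measure :: "'a set \<Rightarrow> 'a measure \<Rightarrow> bool" where
  "arc_measure I M \<longleftrightarrow> space M = I \<and> sets M = sets (restrict_space borel I) \<and>
     (\<forall>u\<in>I. \<forall>v\<in>I. emeasure M (seg u v) = ennreal (l u v))"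

lemma locally_small:
  assumes "e > 0"
  shows "\<exists>d>0. \<forall>z\<in>seg y q. dist y z < d \<longrightarrow> l y z < e"
proof (cases "y = q")
  case True
  then show ?thesis using assms by (auto intro: exI[of _ 1])
next
  case False
  obtain w where w: "w \<in> seg y q" "w \<noteq> y" "l y w < e"
    using l_small[OF False[symmetric] assms] by blast
  have "l y z < e" if z: "z \<in> seg y q" "dist y z < dist y w" for z
    using seg_linear(1)[OF z(1) w(1)] z(2) l_mono[of z y w] w(3) by simp
  then show ?thesis using w(2) by (intro exI[of _ "dist y w"]) auto
qed

text \<open>In the arc length parameter, \<open>F\<close> is a nondecreasing continuous distribution
  function; its Lebesgue-Stieltjes measure is pushed forward to the segment.\<close>

lemma arc_measure_exists: "\<exists>M. arc_measure (seg p q) M"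
proof -
  define L where "L = dist p q"
  obtain \<gamma> where g: "\<And>s t. s\<in>{0..L} \<Longrightarrow> t\<in>{0..L} \<Longrightarrow> dist (\<gamma> s) (\<gamma> t) = \<bar>s - t\<bar>"
    "\<gamma> 0 = p" "\<gamma> L = q" "seg p q = \<gamma> ` {0..L}"
    "\<And>t. t \<in> {0..L} \<Longrightarrow> dist p (\<gamma> t) = t" "continuous_on {0..L} \<gamma>"
    unfolding L_def by (rule seg_param[of p q]) blast
  have L: "L \<ge> 0" by (simp add: L_def)
  define F where "F t = l p (\<gamma> t)" for t
  have diff: "F t = F s + l (\<gamma> s) (\<gamma> t)" if "s \<in> {0..L}" "t \<in> {0..L}" "s \<le> t" for s t
  proof -
    have "\<gamma> s \<in> seg p (\<gamma> t)"
      using seg_linear(1)[of "\<gamma> s" p q "\<gamma> t"] g(4,5) that by simp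
    then show ?thesis unfolding F_def by (rule l_add)
  qed
  have absdiff: "\<bar>F s - F t\<bar> = l (\<gamma> t) (\<gamma> s)" if "s \<in> {0..L}" "t \<in> {0..L}" for s t
    using diff[of s t] diff[of t s] that l_commute[of "\<gamma> s" "\<gamma> t"] l_nonneg[of "\<gamma> s" "\<gamma> t"] by fastforce
  have "continuous_on {0..L} F"
    unfolding continuous_on_iff
  proof (intro ballI allI impI)
    \<comment> \<open>Continuity at t is checked on both sides, with one radius for the direction of
      q and one for that of p.\<close>
    fix t e :: real assume t: "t \<in> {0..L}" and e: "e > 0"
    obtain d1 where d1: "d1 > 0" "\<forall>z\<in>seg (\<gamma> t) q. dist (\<gamma> t) z < d1 \<longrightarrow> l (\<gamma> t) z < e"
      using locally_small[OF e] by blast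
    obtain d2 where d2: "d2 > 0" "\<forall>z\<in>seg (\<gamma> t) p. dist (\<gamma> t) z < d2 \<longrightarrow> l (\<gamma> t) z < e"
      using locally_small[OF e] by blast
    have "dist (F s) (F t) < e" if s: "s \<in> {0..L}" "dist s t < min d1 d2" for s
    proof -
      have "\<gamma> t \<in> seg p q" "\<gamma> s \<in> seg p q" using g(4) s t by auto
      then have "\<gamma> s \<in> seg (\<gamma> t) q \<or> \<gamma> s \<in> seg (\<gamma> t) p"
        using seg_split[of "\<gamma> t" p q] by (auto simp: seg_commute)
      moreover have "dist (\<gamma> t) (\<gamma> s) < min d1 d2"
        using g(1)[OF s(1) t] s(2) by (simp add: dist_commute dist_real_def)
      ultimately have "l (\<gamma> t) (\<gamma> s) < e" using d1(2) d2(2) by auto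
      then show ?thesis using absdiff[OF s(1) t] by (simp add: dist_real_def)
    qed
    then show "\<exists>d>0. \<forall>s\<in>{0..L}. dist s t < d \<longrightarrow> dist (F s) (F t) < e"
      using d1(1) d2(1) by (intro exI[of _ "min d1 d2"]) simp
  qed
  \<comment> \<open>Extending \<open>F\<close> by constants gives a function on the whole line, to
    which \<open>interval_measure\<close> applies.\<close>
  define H where "H t = F (max 0 (min L t))" for t
  have cH: "continuous_on UNIV H"
    unfolding H_def
    by (rule continuous_on_compose2[OF \<open>continuous_on {0..L} F\<close>])
      (use L in \<open>auto intro!: continuous_intros\<close>)
  have mH: "H s \<le> H t" if "s \<le> t" for s t
    unfolding H_def using L diff[of "max 0 (min L s)" "max 0 (min L t)"] l_nonneg that by fastforce
  define N where "N = restrict_space (interval_measure H) {0..L}"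
  define M where "M = distr N (restrict_space borel (seg p q)) \<gamma>"
  have "\<gamma> \<in> borel_measurable (restrict_space borel {0..L})"
    using g(6) by (rule borel_measurable_continuous_on_restrict)
  moreover have sN: "sets N = sets (restrict_space borel {0..L})"
    unfolding N_def by (intro sets_restrict_space_cong) simp
  ultimately have "\<gamma> \<in> borel_measurable N" by (simp cong: measurable_cong_sets)
  moreover have spN: "space N = {0..L}" by (simp add: N_def space_restrict_space)
  ultimately have meas: "\<gamma> \<in> measurable N (restrict_space borel (seg p q))"
    by (intro measurable_restrict_space2) (auto simp: g(4))
  have main: "emeasure M (seg (\<gamma> a) (\<gamma> b)) = ennreal (l (\<gamma> a) (\<gamma> b))"
    if ab: "a \<in> {0..L}" "b \<in> {0..L}" "a \<le> b" for a b
  proof -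
    have "\<gamma> a \<in> seg p q" "\<gamma> b \<in> seg p q" using g(4) ab by auto
    then have "seg (\<gamma> a) (\<gamma> b) \<subseteq> seg p q" by (rule seg_convex)
    then have "seg (\<gamma> a) (\<gamma> b) \<in> sets (restrict_space borel (seg p q))"
      using compact_imp_closed[OF compact_seg] by (auto simp: sets_restrict_space)
    then have "emeasure M (seg (\<gamma> a) (\<gamma> b)) = emeasure N (\<gamma> -` seg (\<gamma> a) (\<gamma> b) \<inter> space N)"
      unfolding M_def by (intro emeasure_distr meas)
    also have "\<gamma> -` seg (\<gamma> a) (\<gamma> b) \<inter> space N = {a..b}"
      using ab g(1) by (auto simp: spN mem_seg)
    also have "emeasure N {a..b} = emeasure (interval_measure H) {a..b}"
      unfolding N_def using ab by (intro emeasure_restrict_space) auto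
    also have "\<dots> = ennreal (H b - H a)"
      using ab(3) mH cH by (rule emeasure_interval_measure_Icc)
    also have "H b - H a = l (\<gamma> a) (\<gamma> b)"
      using diff[OF ab] ab by (simp add: H_def)
    finally show ?thesis .
  qed
  have "arc_measure (seg p q) M"
    unfolding arc_measure_def
  proof (intro conjI ballI)
    show "space M = seg p q" by (simp add: M_def space_restrict_space)
    show "sets M = sets (restrict_space borel (seg p q))" by (simp add: M_def)
    fix u v assume "u \<in> seg p q" "v \<in> seg p q"
    then obtain a b where ab: "a \<in> {0..L}" "b \<in> {0..L}" "u = \<gamma> a" "v = \<gamma> b" using g(4) by auto
    show "emeasure M (seg u v) = ennreal (l u v)"
      using main[of a b] main[of b a] ab by (cases "a \<le> b") (auto simp: seg_commute l_commute)
  qed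
  then show ?thesis by blast
qed

lemma sets_arc_measure:
  assumes "arc_measure I M"
  shows "A \<in> sets M \<longleftrightarrow> (\<exists>B\<in>sets borel. A = I \<inter> B)"
  using assms by (auto simp: arc_measure_def sets_restrict_space)

lemma seg_in_arc_measure:
  assumes "arc_measure (seg p q) M" "u \<in> seg p q" "v \<in> seg p q"
  shows "seg u v \<in> sets M"
  using sets_arc_measure[OF assms(1)] seg_convex[OF assms(2,3)] compact_imp_closed[OF compact_seg]
  by (metis borel_closed inf.absorb_iff2)

lemma arc_measure_total:
  assumes "arc_measure (seg p q) M"
  shows "emeasure M (seg p q) = ennreal (l p q)"
  using assms by (auto simp: arc_measure_def)

text \<open>On the segment \<open>dist p\<close> is injective, so a measure is recovered from its
  push-forward to the line. That one is determined by its finite values on the rays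
  \<open>{x<..}\<close>, whose preimages are complements of initial segments.\<close>

lemma arc_measure_eqI:
  assumes M: "arc_measure (seg p q) M" and N: "arc_measure (seg p q) N"
  shows "M = N"
proof -
  define L where "L = dist p q"
  obtain \<gamma> where g: "seg p q = \<gamma> ` {0..L}"
    "\<And>t. t \<in> {0..L} \<Longrightarrow> dist p (\<gamma> t) = t" "continuous_on {0..L} \<gamma>"
    unfolding L_def by (rule seg_param[of p q]) blast
  have meas: "dist p \<in> borel_measurable K" if "arc_measure (seg p q) K" for K
  proof -
    have "dist p \<in> borel_measurable (restrict_space borel (seg p q))"
      by (intro borel_measurable_continuous_on_restrict continuous_intros)
    then show ?thesis using that measurable_cong_sets unfolding arc_measure_def by blast
  qed
  \<comment> \<open>The right-hand side depends on \<open>l\<close> alone, so it is the same for M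
    and N.\<close>
  have tail: "emeasure (distr K borel (dist p)) {x<..} =
      (if x < 0 then ennreal (l p q) else if x \<ge> L then 0 else ennreal (l p q) - ennreal (l p (\<gamma> x)))"
    if K: "arc_measure (seg p q) K" for K and x :: real
  proof -
    have sp: "space K = seg p q" using K by (simp add: arc_measure_def)
    have "emeasure (distr K borel (dist p)) {x<..} = emeasure K (dist p -` {x<..} \<inter> seg p q)"
      using meas[OF K] by (subst emeasure_distr) (auto simp: sp)
    also have "\<dots> = (if x < 0 then ennreal (l p q) else if x \<ge> L then 0
        else ennreal (l p q) - ennreal (l p (\<gamma> x)))"
    proof -
      consider "x < 0" | "x \<ge> 0" "x \<ge> L" | "0 \<le> x" "x < L" by linarith
      then show ?thesis
      proof cases
        case 1
        then have "x < dist p z" for z using zero_le_dist[of p z] by linarith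
        then have "dist p -` {x<..} \<inter> seg p q = seg p q" by auto
        then show ?thesis using 1 arc_measure_total[OF K] by simp
      next
        case 2
        then have "dist p -` {x<..} \<inter> seg p q = {}" using g(1,2) by auto
        then show ?thesis using 2 by simp
      next
        case 3
        then have gx: "\<gamma> x \<in> seg p q" "dist p (\<gamma> x) = x" using g by auto
        have "dist p -` {x<..} \<inter> seg p q = seg p q - seg p (\<gamma> x)"
        proof (intro equalityI subsetI)
          fix z assume z: "z \<in> dist p -` {x<..} \<inter> seg p q"
          have "z \<notin> seg p (\<gamma> x)"
          proof
            assume "z \<in> seg p (\<gamma> x)"
            then have "dist p z \<le> x"
              using gx(2) zero_le_dist[of z "\<gamma> x"] unfolding mem_seg by linarith
            then show False using z by simp
          qed
          then show "z \<in> seg p q - seg p (\<gamma> x)" using z by blast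
        next
          fix z assume "z \<in> seg p q - seg p (\<gamma> x)"
          then show "z \<in> dist p -` {x<..} \<inter> seg p q"
            using seg_linear(1)[of z p q "\<gamma> x"] gx by force
        qed
        also have "emeasure K (seg p q - seg p (\<gamma> x)) = emeasure K (seg p q) - emeasure K (seg p (\<gamma> x))"
          using seg_in_arc_measure[OF K] gx(1) seg_trans(1)[OF gx(1)] K
          by (intro emeasure_Diff) (auto simp: arc_measure_def)
        finally show ?thesis using 3 K gx(1) by (auto simp: arc_measure_def)
      qed
    qed
    finally show ?thesis .
  qed
  have D: "distr M borel (dist p) = distr N borel (dist p)"
  proof (rule measure_eqI_lessThan)
    show "emeasure (distr M borel (dist p)) {x<..} < \<infinity>" for x
      unfolding tail[OF M] by (auto intro: le_less_trans[OF diff_le_self_ennreal])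
    show "emeasure (distr M borel (dist p)) {x<..} = emeasure (distr N borel (dist p)) {x<..}" for x
      using tail M N by simp
  qed auto
  show ?thesis
  proof (rule measure_eqI)
    show "sets M = sets N" using M N by (simp add: arc_measure_def)
    fix A assume "A \<in> sets M"
    then obtain B where B: "B \<in> sets borel" "A = seg p q \<inter> B" using sets_arc_measure[OF M] by blast
    \<comment> \<open>\<open>R\<close> is the set of parameters of A. Since \<open>dist p\<close>
      inverts the parametrization, A is the preimage of this Borel set under
      \<open>dist p\<close>.\<close>
    define R where "R = \<gamma> -` B \<inter> {0..L}"
    have "\<gamma> \<in> borel_measurable (restrict_space borel {0..L})"
      using g(3) by (rule borel_measurable_continuous_on_restrict)
    then have "R \<in> sets (restrict_space borel {0..L})"
      using measurable_sets[of \<gamma> "restrict_space borel {0..L}" borel B] B(1)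
      by (simp add: R_def space_restrict_space)
    then have R: "R \<in> sets borel" by (auto simp: sets_restrict_space)
    have A: "A = dist p -` R \<inter> seg p q"
      unfolding B(2) R_def g(1) using g(2) by auto
    have "emeasure K A = emeasure (distr K borel (dist p)) R" if K: "arc_measure (seg p q) K" for K
      using emeasure_distr[OF meas[OF K] R] K by (simp add: A arc_measure_def)
    then show "emeasure M A = emeasure N A" using D M N by simp
  qed
qed

lemma arc_measure_restrict:
  assumes M: "arc_measure (seg p q) M" and uv: "u \<in> seg p q" "v \<in> seg p q"
  shows "arc_measure (seg u v) (restrict_space M (seg u v))"
proof -
  have sub: "seg u v \<subseteq> seg p q" using uv by (rule seg_convex)
  have "sets (restrict_space M (seg u v)) = sets (restrict_space (restrict_space borel (seg p q)) (seg u v))"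
    using M unfolding arc_measure_def by (intro sets_restrict_space_cong) blast
  also have "\<dots> = sets (restrict_space borel (seg u v))"
    using sub by (simp add: restrict_restrict_space inf.absorb2 sets_restrict_restrict_space)
  finally have sets: "sets (restrict_space M (seg u v)) = sets (restrict_space borel (seg u v))" .
  have "emeasure (restrict_space M (seg u v)) (seg a b) = ennreal (l a b)"
    if ab: "a \<in> seg u v" "b \<in> seg u v" for a b
  proof -
    have "emeasure (restrict_space M (seg u v)) (seg a b) = emeasure M (seg a b)"
      using seg_in_arc_measure[OF M uv] seg_convex[OF ab] M sub
      by (intro emeasure_restrict_space) (auto simp: arc_measure_def inf.absorb1)
    moreover have "a \<in> seg p q" "b \<in> seg p q" using ab sub by auto
    ultimately show ?thesis using M by (simp add: arc_measure_def)
  qed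
  then show ?thesis
    using sets M sub by (auto simp: arc_measure_def space_restrict_space)
qed

text \<open>The choice is canonical on arcs: there \<open>arc_measure\<close> has exactly one
  solution.\<close>

definition lmeasure :: "'a set \<Rightarrow> 'a measure" where
  "lmeasure I = (SOME M. arc_measure I M)"

lemma arc_measure_lmeasure: "arc_measure (seg p q) (lmeasure (seg p q))"
  unfolding lmeasure_def using arc_measure_exists by (rule someI_ex)

lemma lmeasure_eqI: "arc_measure (seg p q) M \<Longrightarrow> M = lmeasure (seg p q)"
  using arc_measure_eqI arc_measure_lmeasure by blast

lemma finite_arc_iff: "finite_arc (I :: 'a set) \<longleftrightarrow> (\<exists>p q. I = seg p q)"
  by (simp add: finite_arc_def geodesic_iff_seg)

lemma length_measure_lmeasure: "length_measure lmeasure"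
  unfolding length_measure_def
proof (intro conjI allI impI; (elim conjE)?)
  fix I :: "'a set" assume "finite_arc I"
  then obtain p q where I: "I = seg p q" by (auto simp: finite_arc_iff)
  show "space (lmeasure I) = I" "sets (lmeasure I) = sets (restrict_space borel I)"
    using arc_measure_lmeasure[of p q] by (auto simp: I arc_measure_def)
  show "finite_measure (lmeasure I)"
    using arc_measure_lmeasure[of p q] arc_measure_total[OF arc_measure_lmeasure, of p q]
    by (intro finite_measureI) (auto simp: I arc_measure_def)
next
  fix I J :: "'a set" assume "finite_arc I" "finite_arc J" and sub: "J \<subseteq> I"
  then obtain p q u v where I: "I = seg p q" and J: "J = seg u v" by (auto simp: finite_arc_iff)
  have "u \<in> seg p q" "v \<in> seg p q" using sub by (auto simp: I J)
  then show "lmeasure J = restrict_space (lmeasure I) J"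
    using lmeasure_eqI[OF arc_measure_restrict[OF arc_measure_lmeasure]] by (simp add: I J)
qed

lemma nonatomic_lmeasure: "nonatomic_length_measure lmeasure"
  unfolding nonatomic_length_measure_def
proof (intro allI impI ballI)
  fix I :: "'a set" and x assume "finite_arc I" and x: "x \<in> I"
  then obtain p q where I: "I = seg p q" by (auto simp: finite_arc_iff)
  then have "emeasure (lmeasure I) (seg x x) = ennreal (l x x)"
    using arc_measure_lmeasure[of p q] x unfolding arc_measure_def by blast
  then show "emeasure (lmeasure I) {x} = 0" by simp
qed

text \<open>Near a point z outside X the arc is covered by two short segments issuing from z,
  towards p and towards q. Both miss X, so they have length zero by \<open>off\<close>, and z has a
  null neighbourhood in the arc.\<close>

lemma supported_on_lmeasure:
  assumes closed: "\<And>p q. p \<noteq> q \<Longrightarrow> closedin (top_of_set (seg p q)) (X \<inter> seg p q)"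
    and off: "\<And>p q. X \<inter> seg p q = {} \<Longrightarrow> l p q = 0"
  shows "supported_on lmeasure X"
  unfolding supported_on_def Supp_def
proof (intro allI impI subsetI, elim UN_E)
  fix K z \<I> I assume dec: "\<I> \<in> {\<I>. arc_decomposition \<I> K}" and "I \<in> \<I>"
    and z: "z \<in> measure_support (lmeasure I)"
  have "finite_arc I" and IK: "I \<subseteq> K"
    using dec \<open>I \<in> \<I>\<close> by (auto simp: arc_decomposition_def)
  then obtain p q where I: "I = seg p q" by (auto simp: finite_arc_iff)
  have am: "arc_measure I (lmeasure I)" using arc_measure_lmeasure I by simp
  have zI: "z \<in> I" using z am by (simp add: measure_support_def arc_measure_def)
  have supp: "emeasure (lmeasure I) (U \<inter> I) \<noteq> 0" if "open U" "z \<in> U" for U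
    using z am that by (simp add: measure_support_def arc_measure_def)
  have "z \<in> X"
  proof (rule ccontr)
    assume zX: "z \<notin> X"
    \<comment> \<open>A one-point arc has total measure \<open>l p p = 0\<close>, so its support is
      empty.\<close>
    have ne: "p \<noteq> q"
      using supp[of UNIV] arc_measure_total[of p q] am by (auto simp: I)
    obtain C where C: "closed C" "X \<inter> seg p q = seg p q \<inter> C"
      using closed[OF ne] by (auto simp: closedin_closed)
    then have "z \<in> - C" "open (- C)" using zX zI I by auto
    then obtain e where e: "e > 0" "ball z e \<subseteq> - C" using open_contains_ball by blast
    \<comment> \<open>Half the radius keeps the closed segment from z to \<open>w'\<close> inside
      the open ball of radius e, which is disjoint from C.\<close>
    have "\<exists>N\<in>null_sets (lmeasure I). ball z (e / 2) \<inter> seg z w \<subseteq> N" if w: "w \<in> I" for w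
    proof -
      obtain w' where w': "w' \<in> seg z w" "ball z (e / 2) \<inter> seg z w \<subseteq> seg z w'" "dist z w' \<le> e / 2"
        using seg_truncate[of "e / 2" z w] e(1) by auto
      have w'I: "w' \<in> I" using seg_convex[of z p q w] zI w w'(1) I by blast
      have sub: "seg z w' \<subseteq> I" using seg_convex[of z p q w'] zI w'I I by simp
      have "seg z w' \<subseteq> ball z e"
      proof
        fix y assume "y \<in> seg z w'"
        then have "dist z y \<le> dist z w'" using zero_le_dist[of y w'] unfolding mem_seg by linarith
        then show "y \<in> ball z e" using w'(3) e(1) by simp
      qed
      then have "X \<inter> seg z w' = {}" using e(2) C(2) sub I by blast
      then have "emeasure (lmeasure I) (seg z w') = 0"
        using off am zI w'I by (simp add: arc_measure_def)
      moreover have "seg z w' \<in> sets (lmeasure I)"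
        using seg_in_arc_measure[of p q] am zI w'I I by simp
      ultimately show ?thesis using w'(2) by (intro bexI[of _ "seg z w'"] null_setsI)
    qed
    then obtain N1 N2 where N: "N1 \<in> null_sets (lmeasure I)" "N2 \<in> null_sets (lmeasure I)"
      "ball z (e / 2) \<inter> seg z p \<subseteq> N1" "ball z (e / 2) \<inter> seg z q \<subseteq> N2"
      using I by (metis seg_ends)
    have "I = seg z p \<union> seg z q"
      using seg_split[of z p q] zI unfolding I seg_commute[of p z] by blast
    then have "ball z (e / 2) \<inter> I \<subseteq> N1 \<union> N2" using N(3,4) by blast
    moreover have "N1 \<union> N2 \<in> null_sets (lmeasure I)" using N by auto
    ultimately have "emeasure (lmeasure I) (ball z (e / 2) \<inter> I) \<le> 0"
      using emeasure_mono[of _ "N1 \<union> N2" "lmeasure I"] null_setsD1 null_setsD2 by metis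
    then show False using supp[of "ball z (e / 2)"] e(1) by simp
  qed
  then show "z \<in> K \<inter> X" using zI IK by blast
qed

end

section \<open>Invariance of the measure\<close>

locale invariant_continuous_length =
  invariant_length T G \<phi> l + continuous_length T l
  for T :: "'a::metric_space itself" and G :: "('g, 'm) monoid_scheme" (structure) and \<phi> l
begin

lemma act_image_borel:
  assumes g: "g \<in> carrier G" and A: "A \<in> sets borel"
  shows "\<phi> g ` A \<in> sets borel"
proof -
  have ig: "inv g \<in> carrier G" using g group.inv_closed[OF group_G] by simp
  have "continuous_on UNIV (\<phi> (inv g))"
    unfolding continuous_on_iff using dist_act[OF ig] by metis
  then have "\<phi> (inv g) \<in> borel_measurable borel" by (rule borel_measurable_continuous_onI)
  then have "\<phi> (inv g) -` A \<in> sets borel" using measurable_sets[of _ borel borel] A by force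
  moreover have "\<phi> g ` A = \<phi> (inv g) -` A"
    by (rule act_imageI[OF g]) (use g in auto)
  ultimately show ?thesis by simp
qed

text \<open>The push-forward of \<open>lmeasure I\<close> under g has the right values on the
  subsegments of the translated arc because \<open>l\<close> is invariant; uniqueness identifies it
  with \<open>lmeasure\<close> there.\<close>

lemma invariant_lmeasure: "invariant_length_measure G \<phi> lmeasure"
  unfolding invariant_length_measure_def
proof (intro conjI ballI allI impI)
  show "length_measure lmeasure" by (rule length_measure_lmeasure)
  fix g and I A :: "'a set"
  assume g: "g \<in> carrier G" and "finite_arc I" and A: "A \<in> sets borel"
  then obtain p q where I: "I = seg p q" by (auto simp: finite_arc_iff)
  have gI: "\<phi> g ` I = seg (\<phi> g p) (\<phi> g q)" using act_seg[OF g] I by simp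
  define M where "M = lmeasure I"
  have M: "arc_measure I M" using arc_measure_lmeasure I M_def by simp
  define N where "N = distr M (restrict_space borel (\<phi> g ` I)) (\<phi> g)"
  have "continuous_on UNIV (\<phi> g)"
    unfolding continuous_on_iff using dist_act[OF g] by metis
  then have "\<phi> g \<in> borel_measurable (restrict_space borel I)"
    by (intro borel_measurable_continuous_on_restrict) (rule continuous_on_subset[OF _ subset_UNIV])
  then have "\<phi> g \<in> borel_measurable M"
    using M measurable_cong_sets unfolding arc_measure_def by blast
  then have meas: "\<phi> g \<in> measurable M (restrict_space borel (\<phi> g ` I))"
    using M by (intro measurable_restrict_space2) (auto simp: arc_measure_def)
  have eN: "emeasure N (\<phi> g ` B) = emeasure M B" if B: "B \<in> sets borel" "B \<subseteq> I" for B
  proof -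
    have "\<phi> g ` B \<in> sets (restrict_space borel (\<phi> g ` I))"
      using act_image_borel[OF g B(1)] B(2) by (auto simp: sets_restrict_space)
    then have "emeasure N (\<phi> g ` B) = emeasure M (\<phi> g -` \<phi> g ` B \<inter> space M)"
      unfolding N_def by (rule emeasure_distr[OF meas])
    also have "\<phi> g -` \<phi> g ` B \<inter> space M = B"
      using B(2) M g by (auto simp: arc_measure_def)
    finally show ?thesis .
  qed
  have "arc_measure (seg (\<phi> g p) (\<phi> g q)) N"
    unfolding arc_measure_def
  proof (intro conjI ballI)
    show "space N = seg (\<phi> g p) (\<phi> g q)" by (simp add: N_def gI space_restrict_space)
    show "sets N = sets (restrict_space borel (seg (\<phi> g p) (\<phi> g q)))" by (simp add: N_def gI)
    fix u v assume "u \<in> seg (\<phi> g p) (\<phi> g q)" "v \<in> seg (\<phi> g p) (\<phi> g q)"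
    then obtain u' v' where uv: "u' \<in> I" "v' \<in> I" "u = \<phi> g u'" "v = \<phi> g v'" using gI by blast
    have "emeasure N (\<phi> g ` seg u' v') = emeasure M (seg u' v')"
      using seg_convex[of u' p q v'] uv I compact_imp_closed[OF compact_seg]
      by (intro eN) auto
    also have "\<dots> = ennreal (l u' v')" using M uv by (simp add: arc_measure_def)
    finally show "emeasure N (seg u v) = ennreal (l u v)"
      using uv g by (simp add: act_seg l_act)
  qed
  then have "N = lmeasure (\<phi> g ` I)" using lmeasure_eqI gI by simp
  moreover have "A \<inter> I \<in> sets borel"
    using A compact_imp_closed[OF compact_seg] by (auto simp: I)
  ultimately show "emeasure (lmeasure (\<phi> g ` I)) (\<phi> g ` (A \<inter> I)) = emeasure (lmeasure I) (A \<inter> I)"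
    using eN[of "A \<inter> I"] M_def by simp
qed

end

section \<open>Packing numbers and their limit\<close>

definition separated_sets :: "real \<Rightarrow> 'a::metric_space set \<Rightarrow> 'a set set" where
  "separated_sets e A = {S. finite S \<and> S \<subseteq> A \<and> pairwise (\<lambda>a b. e \<le> dist a b) S}"

text \<open>For e > 0 the sizes are bounded by \<open>card_separated_le\<close> and the empty set is
  separated, so \<open>Max\<close> is a genuine maximum.\<close>

definition packing :: "'a::metric_space set \<Rightarrow> real \<Rightarrow> 'a \<Rightarrow> 'a \<Rightarrow> nat" where
  "packing X e p q = Max (card ` separated_sets e (X \<inter> seg p q))"

lemma separated_sets_mono:
  "S \<in> separated_sets e A \<Longrightarrow> S' \<subseteq> S \<Longrightarrow> S' \<subseteq> B \<Longrightarrow> S' \<in> separated_sets e B"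
  unfolding separated_sets_def using finite_subset pairwise_subset by blast

lemma packing_commute: "packing X e p q = packing X e q p"
  by (simp add: packing_def seg_commute)

section \<open>Packing numbers along segments\<close>

context tree_space
begin

text \<open>Divide the segment into half-open cells of length e, numbered by \<open>f\<close>; two
  points in one cell are closer than e.\<close>

lemma card_separated_le:
  assumes "e > 0" "S \<in> separated_sets e (X \<inter> seg (p::'a) q)"
  shows "card S \<le> Suc (nat \<lfloor>dist p q / e\<rfloor>)"
proof -
  define f where "f s = nat \<lfloor>dist p s / e\<rfloor>" for s
  have S: "S \<subseteq> seg p q" "pairwise (\<lambda>a b. e \<le> dist a b) S"
    using assms(2) by (auto simp: separated_sets_def)
  have "inj_on f S"
  proof (rule inj_onI, rule ccontr)
    fix s t assume st: "s \<in> S" "t \<in> S" "f s = f t" "s \<noteq> t"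
    have "\<lfloor>dist p s / e\<rfloor> = \<lfloor>dist p t / e\<rfloor>"
      using st(3) assms(1) by (simp add: f_def nat_eq_iff2)
    then have "\<bar>dist p s / e - dist p t / e\<bar> < 1" by linarith
    then have "\<bar>(dist p s - dist p t) / e\<bar> < 1" by (simp add: diff_divide_distrib)
    then have "\<bar>dist p s - dist p t\<bar> < e" using assms(1) by (simp add: field_simps)
    moreover have "s \<in> seg p q" "t \<in> seg p q" using st S(1) by auto
    ultimately have "dist s t < e" using dist_on_seg[of s p q t] by simp
    then show False using S(2) st by (force simp: pairwise_def)
  qed
  moreover have "f ` S \<subseteq> {..nat \<lfloor>dist p q / e\<rfloor>}"
  proof (rule image_subsetI)
    fix s assume "s \<in> S"
    then have "s \<in> seg p q" using S(1) by blast
    then have "dist p s \<le> dist p q" using zero_le_dist[of s q] unfolding mem_seg by linarith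
    then show "f s \<in> {..nat \<lfloor>dist p q / e\<rfloor>}"
      using assms(1) by (auto simp: f_def intro!: nat_mono floor_mono divide_right_mono)
  qed
  ultimately have "card S \<le> card {..nat \<lfloor>dist p q / e\<rfloor>}" by (intro card_inj_on_le) auto
  then show ?thesis by simp
qed

lemma finite_card_separated:
  assumes "e > 0"
  shows "finite (card ` separated_sets e (X \<inter> seg (p::'a) q))"
  by (rule finite_subset[of _ "{..Suc (nat \<lfloor>dist p q / e\<rfloor>)}"])
    (use card_separated_le[OF assms] in auto)

lemma packing_ge:
  assumes "e > 0" "S \<in> separated_sets e (X \<inter> seg (p::'a) q)"
  shows "card S \<le> packing X e p q"
  unfolding packing_def using finite_card_separated assms by (intro Max_ge) auto

lemma packing_attained:
  assumes "e > 0"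
  obtains S where "S \<in> separated_sets e (X \<inter> seg (p::'a) q)" "card S = packing X e p q"
proof -
  have "{} \<in> separated_sets e (X \<inter> seg p q)" by (simp add: separated_sets_def)
  then have "packing X e p q \<in> card ` separated_sets e (X \<inter> seg p q)"
    unfolding packing_def using finite_card_separated[OF assms] by (intro Max_in) auto
  then show ?thesis using that by auto
qed

lemma packing_mono:
  assumes "e > 0" "seg (p::'a) q \<subseteq> seg p' q'"
  shows "packing X e p q \<le> packing X e p' q'"
proof -
  obtain S where S: "S \<in> separated_sets e (X \<inter> seg p q)" "card S = packing X e p q"
    by (rule packing_attained[OF assms(1)])
  have "S \<in> separated_sets e (X \<inter> seg p' q')"
    using separated_sets_mono[OF S(1) subset_refl] S(1) assms(2) by (auto simp: separated_sets_def)
  then show ?thesis using packing_ge[OF assms(1)] S(2) by metis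
qed

lemma packing_triangle:
  assumes "e > 0"
  shows "packing X e (p::'a) q \<le> packing X e p r + packing X e r q"
proof -
  obtain S where S: "S \<in> separated_sets e (X \<inter> seg p q)" "card S = packing X e p q"
    by (rule packing_attained[OF assms])
  have sub: "S \<subseteq> X \<inter> seg p q" using S(1) by (simp add: separated_sets_def)
  have "S = (S \<inter> seg p r) \<union> (S \<inter> seg r q)" using sub seg_subset_Un[of p q r] by blast
  then have "card S \<le> card (S \<inter> seg p r) + card (S \<inter> seg r q)" by (metis card_Un_le)
  moreover have "S \<inter> seg p r \<in> separated_sets e (X \<inter> seg p r)"
    "S \<inter> seg r q \<in> separated_sets e (X \<inter> seg r q)"
    using sub by (auto intro!: separated_sets_mono[OF S(1)])
  then have "card (S \<inter> seg p r) \<le> packing X e p r" "card (S \<inter> seg r q) \<le> packing X e r q"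
    using packing_ge[OF assms] by blast+
  ultimately show ?thesis using S(2) by linarith
qed

text \<open>An optimal set on the first half loses at most one point, the one closer than e to c;
  the rest unites with an optimal set on the second half. The defect 1 disappears in the normalized
  limit.\<close>

lemma packing_add:
  assumes e: "e > 0" and c: "(c::'a) \<in> seg p q"
  shows "packing X e p c + packing X e c q \<le> packing X e p q + 1"
proof -
  obtain S1 where S1: "S1 \<in> separated_sets e (X \<inter> seg p c)" "card S1 = packing X e p c"
    by (rule packing_attained[OF e])
  obtain S2 where S2: "S2 \<in> separated_sets e (X \<inter> seg c q)" "card S2 = packing X e c q"
    by (rule packing_attained[OF e])
  have fin: "finite S1" "finite S2" and sub: "S1 \<subseteq> X \<inter> seg p c" "S2 \<subseteq> X \<inter> seg c q"
    and sep: "pairwise (\<lambda>a b. e \<le> dist a b) S1" "pairwise (\<lambda>a b. e \<le> dist a b) S2"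
    using S1(1) S2(1) by (auto simp: separated_sets_def)
  define R where "R = {s \<in> S1. e \<le> dist s c}"
  define Q where "Q = {s \<in> S1. dist s c < e}"
  \<comment> \<open>Two points on the same side of c, both closer than e to it, are closer than e to
    each other.\<close>
  have "s = t" if st: "s \<in> Q" "t \<in> Q" for s t
  proof (rule ccontr)
    assume "s \<noteq> t"
    then have "e \<le> dist s t" using sep(1) st by (auto simp: Q_def pairwise_def)
    moreover have "dist s t = \<bar>dist c s - dist c t\<bar>"
      using st sub(1) by (intro dist_on_seg[of s c p t]) (auto simp: Q_def seg_commute)
    moreover have "dist c s < e" "dist c t < e" using st by (auto simp: Q_def dist_commute)
    ultimately show False using zero_le_dist[of c s] zero_le_dist[of c t] by linarith
  qed
  moreover have "finite Q" using fin by (simp add: Q_def)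
  ultimately have "card Q \<le> 1" using card_le_Suc0_iff_eq[of Q] by auto
  moreover have "S1 = R \<union> Q" by (auto simp: R_def Q_def)
  then have "card S1 \<le> card R + card Q" by (metis card_Un_le)
  ultimately have cR: "card S1 \<le> card R + 1" by linarith
  have far: "e \<le> dist s t" if "s \<in> R" "t \<in> S2" for s t
  proof -
    have "s \<in> seg p c" "t \<in> seg c q" using that sub by (auto simp: R_def)
    then have "c \<in> seg s q" using seg_trans(2)[OF c] by blast
    then have "c \<in> seg s t" using seg_trans'(2) \<open>t \<in> seg c q\<close> by blast
    then have "dist s t = dist s c + dist c t" by (simp add: mem_seg)
    moreover have "e \<le> dist s c" using that by (simp add: R_def)
    ultimately show ?thesis using zero_le_dist[of c t] by linarith
  qed
  then have far': "e \<le> dist t s" if "s \<in> R" "t \<in> S2" for s t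
    using that by (simp add: dist_commute)
  have "R \<inter> S2 = {}" using far e by force
  then have "card (R \<union> S2) = card R + card S2"
    using fin by (intro card_Un_disjoint) (auto simp: R_def)
  moreover have "R \<union> S2 \<in> separated_sets e (X \<inter> seg p q)"
  proof -
    have "R \<union> S2 \<subseteq> X \<inter> seg p q" using sub seg_split[OF c] by (auto simp: R_def)
    moreover have "pairwise (\<lambda>a b. e \<le> dist a b) (R \<union> S2)"
      using far far' sep unfolding pairwise_def R_def by auto
    ultimately show ?thesis using fin by (simp add: separated_sets_def R_def)
  qed
  ultimately show ?thesis using packing_ge[OF e] S1(2) S2(2) cR by fastforce
qed

lemma packing_disjoint:
  assumes "e > 0" "X \<inter> seg (p::'a) q = {}"
  shows "packing X e p q = 0"
proof -
  obtain S where "S \<in> separated_sets e (X \<inter> seg p q)" "card S = packing X e p q"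
    by (rule packing_attained[OF assms(1)])
  then show ?thesis using assms(2) by (auto simp: separated_sets_def)
qed

text \<open>Any n points of the infinite set are separated at every scale up to their smallest
  mutual distance.\<close>

lemma packing_unbounded:
  assumes "infinite (X \<inter> seg (p::'a) q)"
  obtains d where "d > 0" "\<And>e. 0 < e \<Longrightarrow> e \<le> d \<Longrightarrow> n \<le> packing X e p q"
proof -
  obtain S where S: "finite S" "card S = n" "S \<subseteq> X \<inter> seg p q"
    using infinite_arbitrarily_large[OF assms] by blast
  \<comment> \<open>The extra element 1 keeps \<open>D\<close> nonempty when S has no two distinct
    points.\<close>
  define D where "D = insert 1 ((\<lambda>(a, b). dist a b) ` (S \<times> S - Id))"
  have fin: "finite D" using S(1) by (simp add: D_def)
  have "Min D \<in> D" using fin by (intro Min_in) (auto simp: D_def)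
  then have "Min D > 0" by (auto simp: D_def)
  moreover have "n \<le> packing X e p q" if e: "0 < e" "e \<le> Min D" for e
  proof -
    have "e \<le> dist a b" if "a \<in> S" "b \<in> S" "a \<noteq> b" for a b
      using Min_le[OF fin, of "dist a b"] that e(2) by (force simp: D_def)
    then have "S \<in> separated_sets e (X \<inter> seg p q)" using S by (auto simp: separated_sets_def pairwise_def)
    then show ?thesis using packing_ge[OF e(1)] S(2) by blast
  qed
  ultimately show ?thesis using that by blast
qed

end

text \<open>By Tychonoff: all \<open>f k\<close> lie in a product of compact intervals, hence they
  cluster at some l. A filter replaces a subsequence, since the index set may be
  uncountable.\<close>

lemma pointwise_cluster_limit:
  fixes f :: "nat \<Rightarrow> 'i \<Rightarrow> real"
  assumes bdd: "\<And>i. \<exists>C. \<forall>k. \<bar>f k i\<bar> \<le> C"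
  obtains F l where "F \<noteq> bot" "F \<le> sequentially" "\<And>i. ((\<lambda>k. f k i) \<longlongrightarrow> l i) F"
proof -
  from bdd obtain C where C: "\<And>i k. \<bar>f k i\<bar> \<le> C i" by metis
  define K where "K = (\<Pi>\<^sub>E i\<in>UNIV. {- C i..C i})"
  have "compactin (product_topology (\<lambda>i. euclidean) UNIV) K"
    unfolding K_def compactin_PiE by simp
  then have "compact K" by (simp add: euclidean_product_topology)
  moreover have "f k \<in> K" for k
    using C[of k] by (auto simp: K_def abs_le_iff minus_le_iff)
  then have "eventually (\<lambda>x. x \<in> K) (filtermap f sequentially)"
    by (simp add: eventually_filtermap)
  moreover have "filtermap f sequentially \<noteq> bot" by (simp add: filtermap_bot_iff)
  ultimately obtain l where l: "inf (nhds l) (filtermap f sequentially) \<noteq> bot"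
    unfolding compact_filter by blast
  \<comment> \<open>\<open>F\<close> is generated by the sets of late indices k for which
    \<open>f k\<close> is close to l; it is proper because l is a cluster point.\<close>
  define F where "F = inf (filtercomap f (nhds l)) sequentially"
  have "F \<noteq> bot"
  proof
    assume "F = bot"
    then have "eventually (\<lambda>_. False) F" by simp
    then obtain P Q where PQ: "eventually P (filtercomap f (nhds l))" "eventually Q sequentially"
      "\<And>k. P k \<and> Q k \<Longrightarrow> False"
      unfolding F_def eventually_inf by blast
    obtain R where R: "eventually R (nhds l)" "\<And>k. R (f k) \<Longrightarrow> P k"
      using PQ(1) by (auto simp: eventually_filtercomap)
    have "eventually (\<lambda>x. \<not> R x) (filtermap f sequentially)"
      using PQ(2) unfolding eventually_filtermap by eventually_elim (use PQ(3) R(2) in blast)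
    then have "eventually (\<lambda>_. False) (inf (nhds l) (filtermap f sequentially))"
      unfolding eventually_inf using R(1) by blast
    then show False using l by (simp add: trivial_limit_def)
  qed
  moreover have "F \<le> sequentially" by (simp add: F_def)
  moreover have "((\<lambda>k. f k i) \<longlongrightarrow> l i) F" for i
  proof -
    have "filterlim f (nhds l) (filtercomap f (nhds l))" by (rule filterlim_filtercomap)
    then have fl: "(f \<longlongrightarrow> l) F" unfolding F_def by (rule filterlim_mono) auto
    have co: "continuous_on UNIV (\<lambda>x :: 'i \<Rightarrow> real. x i)" by (rule continuous_on_product_coordinates)
    show ?thesis using continuous_on_tendsto_compose[OF co fl] by simp
  qed
  ultimately show ?thesis using that by blast
qed

section \<open>The limit of the packing numbers as an invariant length\<close>

context tree_action
begin

lemma packing_act: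
  assumes g: "g \<in> carrier G" and X: "invariant_set G \<phi> X"
  shows "packing X e (\<phi> g p) (\<phi> g q) = packing X e p q"
proof -
  have act_le: "card ` separated_sets e (X \<inter> seg p q) \<subseteq> card ` separated_sets e (X \<inter> seg (\<phi> g p) (\<phi> g q))"
    if g: "g \<in> carrier G" for g p q
  proof
    fix n assume "n \<in> card ` separated_sets e (X \<inter> seg p q)"
    then obtain S where S: "S \<in> separated_sets e (X \<inter> seg p q)" "n = card S" by blast
    have inj: "inj_on (\<phi> g) S" using g by (auto simp: inj_on_def)
    have "\<phi> g ` X = X" using X g by (simp add: invariant_set_def)
    then have "\<phi> g ` S \<subseteq> X \<inter> seg (\<phi> g p) (\<phi> g q)"
      using S(1) g by (auto simp: separated_sets_def)
    moreover have "pairwise (\<lambda>a b. e \<le> dist a b) (\<phi> g ` S)"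
      using S(1) g by (auto simp: separated_sets_def pairwise_def dist_act)
    ultimately have "\<phi> g ` S \<in> separated_sets e (X \<inter> seg (\<phi> g p) (\<phi> g q))"
      using S(1) by (auto simp: separated_sets_def)
    moreover have "n = card (\<phi> g ` S)" using card_image[OF inj] S(2) by simp
    ultimately show "n \<in> card ` separated_sets e (X \<inter> seg (\<phi> g p) (\<phi> g q))" by blast
  qed
  have "card ` separated_sets e (X \<inter> seg (\<phi> g p) (\<phi> g q)) \<subseteq> card ` separated_sets e (X \<inter> seg p q)"
    using act_le[of "inv g" "\<phi> g p" "\<phi> g q"] g group.inv_closed[OF group_G] by simp
  then have "card ` separated_sets e (X \<inter> seg (\<phi> g p) (\<phi> g q)) = card ` separated_sets e (X \<inter> seg p q)"
    using act_le[OF g] by blast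
  then show ?thesis by (simp add: packing_def)
qed

text \<open>The union of the segments from x to its orbit points is connected. It is invariant
  because g maps \<open>seg x (\<phi> h x)\<close> to a segment between two orbit points, which is
  covered by the segments from x to them. Minimality makes it the whole tree.\<close>

lemma mem_seg_orbit:
  assumes "minimal_action G \<phi>"
  obtains g where "g \<in> carrier G" "(y::'a) \<in> seg x (\<phi> g x)"
proof -
  define S where "S = (\<Union>g\<in>carrier G. seg x (\<phi> g x))"
  have one: "\<one> \<in> carrier G" by (rule monoid.one_closed[OF group.is_monoid[OF group_G]])
  have "x \<in> S" using one by (auto simp: S_def)
  moreover have "seg x y \<subseteq> S" if "y \<in> S" for y
    using that seg_convex[OF seg_ends(1)] unfolding S_def by blast
  ultimately have "subtree S"
    using connected_if_seg_subset[of x S] by (auto simp: subtree_def)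
  moreover have sub: "\<phi> g y \<in> S" if g: "g \<in> carrier G" and y: "y \<in> S" for g y
  proof -
    obtain h where h: "h \<in> carrier G" "y \<in> seg x (\<phi> h x)" using y by (auto simp: S_def)
    have gh: "g \<otimes> h \<in> carrier G" by (rule monoid.m_closed[OF group.is_monoid[OF group_G] g h(1)])
    have "\<phi> g y \<in> seg (\<phi> g x) (\<phi> (g \<otimes> h) x)" using h g by (simp add: act_mult)
    then have "\<phi> g y \<in> seg x (\<phi> g x) \<or> \<phi> g y \<in> seg x (\<phi> (g \<otimes> h) x)"
      using seg_subset_Un[of "\<phi> g x" "\<phi> (g \<otimes> h) x" x] by (auto simp: seg_commute)
    then show ?thesis using g gh by (auto simp: S_def)
  qed
  then have "invariant_set G \<phi> S"
    unfolding invariant_set_def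
  proof (intro ballI act_imageI iffI)
    fix g y assume g: "g \<in> carrier G" and "\<phi> g y \<in> S"
    then have "\<phi> (inv g) (\<phi> g y) \<in> S" using sub group.inv_closed[OF group_G] by blast
    then show "y \<in> S" using g by simp
  qed
  ultimately have "S = UNIV" using assms by (simp add: minimal_action_def)
  then have "y \<in> S" by simp
  then show ?thesis using that by (auto simp: S_def)
qed

lemma invariant_length_exists:
  assumes S: "finite S" "S \<subseteq> carrier G" "generate G S = carrier G"
    and min: "minimal_action G \<phi>" and X: "invariant_set G \<phi> X" and inf: "infinite (X \<inter> seg a b)"
  obtains l where "invariant_length T G \<phi> l" "\<And>p q. X \<inter> seg p q = {} \<Longrightarrow> l p q = 0"
    "\<exists>p q. l p q \<noteq> 0"
proof -
  define x where "x = a"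
  define e where "e k = 1 / (real k + 1)" for k :: nat
  have e: "e k > 0" for k by (simp add: e_def)
  define P where "P k p q = packing X (e k) p q" for k p q
  \<comment> \<open>The summand 1 keeps \<open>N\<close> positive and makes room for
    \<open>P k x x\<close>, which is 1 when x lies in X.\<close>
  define N where "N k = (\<Sum>s\<in>S. P k x (\<phi> s x)) + 1" for k
  have tri: "P k p q \<le> P k p r + P k r q" for k p q r
    unfolding P_def by (rule packing_triangle[OF e])
  have comm: "P k p q = P k q p" for k p q unfolding P_def by (rule packing_commute)
  have act: "P k (\<phi> g p) (\<phi> g q) = P k p q" if "g \<in> carrier G" for k g p q
    unfolding P_def by (rule packing_act[OF that X])
  have N1: "N k \<ge> 1" for k by (simp add: N_def)
  have gen: "P k x (\<phi> s x) \<le> N k" if "s \<in> S" for s k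
  proof -
    have "P k x (\<phi> s x) \<le> (\<Sum>s\<in>S. P k x (\<phi> s x))"
      using that S(1) by (intro member_le_sum) auto
    then show ?thesis by (simp add: N_def)
  qed
  \<comment> \<open>The constant depends on g but not on the scale: the triangle inequality and
    invariance bound the displacement of x under a product by the displacements under its
    factors.\<close>
  have orbit_bound: "\<exists>C. \<forall>k. P k x (\<phi> g x) \<le> C * N k" if "g \<in> generate G S" for g
    using that
  proof (induction rule: generate.induct)
    case one
    have "P k x x \<le> 1" for k
    proof -
      obtain B where B: "B \<in> separated_sets (e k) (X \<inter> seg x x)" "card B = P k x x"
        unfolding P_def by (rule packing_attained[OF e])
      then have "B \<subseteq> {x}" by (auto simp: separated_sets_def)
      then have "card B \<le> card {x}" by (intro card_mono) auto
      then show ?thesis using B(2) by simp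
    qed
    then show ?case using N1 le_trans by (intro exI[of _ 1]) (auto intro: le_trans)
  next
    case (incl h)
    then show ?case using gen by (intro exI[of _ 1]) auto
  next
    case (inv h)
    then have h: "h \<in> carrier G" using S(2) by blast
    have "P k x (\<phi> (inv h) x) = P k x (\<phi> h x)" for k
      using act[OF h, of k x "\<phi> (inv h) x"] h comm by simp
    then show ?case using gen[OF inv] by (intro exI[of _ 1]) auto
  next
    case (eng g h)
    then have gh: "g \<in> carrier G" "h \<in> carrier G" using S(3) by auto
    obtain C D where CD: "\<And>k. P k x (\<phi> g x) \<le> C * N k" "\<And>k. P k x (\<phi> h x) \<le> D * N k"
      using eng by blast
    have "P k x (\<phi> (g \<otimes> h) x) \<le> (C + D) * N k" for k
    proof -
      have "P k x (\<phi> (g \<otimes> h) x) \<le> P k x (\<phi> g x) + P k (\<phi> g x) (\<phi> g (\<phi> h x))"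
        using tri gh by (simp add: act_mult)
      also have "\<dots> \<le> C * N k + D * N k" using CD[of k] act[OF gh(1)] by (simp add: add_mono)
      finally show ?thesis by (simp add: algebra_simps)
    qed
    then show ?case by blast
  qed
  have bound0: "\<exists>C. \<forall>k. P k x y \<le> C * N k" for y
  proof -
    obtain g where g: "g \<in> carrier G" "y \<in> seg x (\<phi> g x)" by (rule mem_seg_orbit[OF min])
    have "P k x y \<le> P k x (\<phi> g x)" for k
      unfolding P_def using g(2) by (intro packing_mono e seg_convex) auto
    moreover obtain C where "\<And>k. P k x (\<phi> g x) \<le> C * N k"
      using orbit_bound[of g] g(1) S(3) by auto
    ultimately show ?thesis using le_trans by blast
  qed
  have bound: "\<exists>C. \<forall>k. P k p q \<le> C * N k" for p q
  proof -
    obtain C D where CD: "\<And>k. P k x p \<le> C * N k" "\<And>k. P k x q \<le> D * N k"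
      using bound0 by meson
    have "P k p q \<le> (C + D) * N k" for k
      using tri[of k p q x] CD[of k] comm[of k p x] by (simp add: algebra_simps)
    then show ?thesis by blast
  qed
  define f where "f k i = real (P k (fst i) (snd i)) / real (N k)" for k and i :: "'a \<times> 'a"
  have "\<exists>C. \<forall>k. \<bar>f k i\<bar> \<le> C" for i
  proof -
    obtain C where C: "\<And>k. P k (fst i) (snd i) \<le> C * N k" using bound by blast
    have "\<bar>f k i\<bar> \<le> real C" for k
    proof -
      have "real (P k (fst i) (snd i)) \<le> real C * real (N k)"
        using C[of k] by (metis of_nat_le_iff of_nat_mult)
      then show ?thesis using N1[of k] by (simp add: f_def divide_le_eq)
    qed
    then show ?thesis by blast
  qed
  then obtain F L where F: "F \<noteq> bot" "F \<le> sequentially" "\<And>i. ((\<lambda>k. f k i) \<longlongrightarrow> L i) F"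
    using pointwise_cluster_limit[of f] by blast
  define l where "l p q = L (p, q)" for p q
  have lim: "((\<lambda>k. real (P k p q) / real (N k)) \<longlongrightarrow> l p q) F" for p q
    using F(3)[of "(p, q)"] by (simp add: f_def l_def)
  \<comment> \<open>Between a and b the packing numbers exceed every bound at small scales, yet they
    are at most \<open>C * N k\<close>. The factor \<open>Suc C\<close> permits cancellation even if
    C is 0.\<close>
  have "filterlim N at_top sequentially"
    unfolding filterlim_at_top
  proof
    fix m
    obtain C where C: "\<And>k. P k a b \<le> C * N k" using bound by blast
    obtain d where d: "d > 0" "\<And>e. 0 < e \<Longrightarrow> e \<le> d \<Longrightarrow> Suc C * m \<le> packing X e a b"
      using packing_unbounded[OF inf, of "Suc C * m"] by blast
    have "e \<longlonglongrightarrow> 0" unfolding e_def by real_asymp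
    then have "eventually (\<lambda>k. e k < d) sequentially" using d(1) by (rule order_tendstoD)
    then show "eventually (\<lambda>k. m \<le> N k) sequentially"
    proof eventually_elim
      case (elim k)
      then have "Suc C * m \<le> C * N k" using d(2)[OF e, of k] C[of k] by (simp add: P_def)
      also have "\<dots> \<le> Suc C * N k" by simp
      finally show ?case by (simp only: mult_le_cancel1)
    qed
  qed
  then have "filterlim (\<lambda>k. real (N k)) at_top sequentially"
    by (rule filterlim_compose[OF filterlim_real_sequentially])
  then have "(\<lambda>k. 1 / real (N k)) \<longlonglongrightarrow> 0" by (intro tendsto_divide_0[OF tendsto_const] filterlim_at_top_imp_at_infinity)
  then have zero: "((\<lambda>k. 1 / real (N k)) \<longlongrightarrow> 0) F" using F(2) by (rule tendsto_mono[rotated])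
  have uniq: "u = v" if "(h \<longlongrightarrow> u) F" "(h \<longlongrightarrow> v) F" for h and u v :: real
    using tendsto_unique[OF F(1)] that by blast
  have "invariant_length T G \<phi> l"
  proof (unfold_locales)
    show "0 \<le> l x y" for x y
      using F(1) lim[of x y] by (intro tendsto_lowerbound[OF _ _ F(1)]) auto
    show "l x y = l y x" for x y
      using uniq[OF lim[of x y]] lim[of y x] comm[of _ x y] by simp
    show "l (\<phi> g x) (\<phi> g y) = l x y" if "g \<in> carrier G" for g x y
      using uniq[OF lim[of "\<phi> g x" "\<phi> g y"]] lim[of x y] act[OF that] by simp
    fix z u v :: 'a assume z: "z \<in> seg u v"
    \<comment> \<open>\<open>h\<close> is the normalized defect of additivity; it lies between 0 and
      \<open>1 / N k\<close>.\<close>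
    define h where "h k = real (P k u z) / real (N k) + real (P k z v) / real (N k) - real (P k u v) / real (N k)" for k
    have "(h \<longlongrightarrow> l u z + l z v - l u v) F"
      unfolding h_def by (intro tendsto_intros lim)
    moreover have "(h \<longlongrightarrow> 0) F"
    proof (rule tendsto_sandwich[OF _ _ tendsto_const zero])
      have "0 \<le> h k \<and> h k \<le> 1 / real (N k)" for k
      proof -
        have "P k u v \<le> P k u z + P k z v" by (rule tri)
        moreover have "P k u z + P k z v \<le> P k u v + 1"
          unfolding P_def by (rule packing_add[OF e z])
        ultimately have "0 \<le> real (P k u z) + real (P k z v) - real (P k u v)"
          "real (P k u z) + real (P k z v) - real (P k u v) \<le> 1" by linarith+
        then show ?thesis unfolding h_def using N1[of k]
          by (simp add: add_divide_distrib[symmetric] diff_divide_distrib[symmetric] divide_right_mono)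
      qed
      then show "eventually (\<lambda>k. 0 \<le> h k) F" "eventually (\<lambda>k. h k \<le> 1 / real (N k)) F" by auto
    qed
    ultimately show "l u v = l u z + l z v" using uniq by fastforce
  qed
  moreover have "l p q = 0" if "X \<inter> seg p q = {}" for p q
    using uniq[OF lim[of p q], of 0] packing_disjoint[OF e that] by (simp add: P_def)
  \<comment> \<open>The normalized sum over the generators plus \<open>1 / N k\<close> is
    identically 1; if all limits vanished, it would tend to 0.\<close>
  moreover have "\<exists>p q. l p q \<noteq> 0"
  proof (rule ccontr)
    assume "\<nexists>p q. l p q \<noteq> 0"
    then have "((\<lambda>k. \<Sum>s\<in>S. real (P k x (\<phi> s x)) / real (N k)) \<longlongrightarrow> (\<Sum>s\<in>S. 0)) F"
      using lim by (intro tendsto_sum) metis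
    then have "((\<lambda>k. (\<Sum>s\<in>S. real (P k x (\<phi> s x)) / real (N k)) + 1 / real (N k)) \<longlongrightarrow> 0 + 0) F"
      using zero by (intro tendsto_add) auto
    moreover have "(\<Sum>s\<in>S. real (P k x (\<phi> s x)) / real (N k)) + 1 / real (N k) = 1" for k
    proof -
      have "real (N k) = (\<Sum>s\<in>S. real (P k x (\<phi> s x))) + 1" by (simp add: N_def)
      then show ?thesis using N1[of k]
        by (simp add: sum_divide_distrib[symmetric] add_divide_distrib[symmetric])
    qed
    ultimately have "((\<lambda>k. 1 :: real) \<longlongrightarrow> 0) F" by simp
    then show False using uniq[of "\<lambda>_. 1" 1 0] by simp
  qed
  ultimately show ?thesis using that by blast
qed

end

section \<open>Existence of the measure\<close>

lemma infinite_cantor_set: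
  assumes "cantor_set C"
  shows "infinite C"
proof
  assume fin: "finite C"
  from assms obtain f g where "homeomorphic_maps (top_of_set C)
      (product_topology (\<lambda>_::nat. discrete_topology (UNIV :: bool set)) UNIV) f g"
    unfolding cantor_set_def homeomorphic_space_def by blast
  then have "f ` C = UNIV"
    using homeomorphic_imp_surjective_map[of "top_of_set C" _ f] homeomorphic_maps_map by fastforce
  then have "finite (UNIV :: (nat \<Rightarrow> bool) set)" using fin by (metis finite_imageI)
  then have "finite (UNIV :: nat set)" by (rule finite_fun_UNIVD1) simp
  then show False by simp
qed

theorem proposition1p5:
  fixes n :: nat
    and G :: "('g, 'm) monoid_scheme"
    and \<phi> :: "'g \<Rightarrow> 'a::metric_space \<Rightarrow> 'a"
    and X :: "'a set"
  assumes "n \<ge> 2"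
    and "cv_bar n G \<phi>"
    and "dense_orbits G \<phi>"
    and "\<not> splits_as_graph_of_actions G \<phi>"
    and "exceptional_set G \<phi> X"
  shows "\<exists>\<mu>\<in>M0 G \<phi>. nonzero_length_measure \<mu> \<and> supported_on \<mu> X"
proof -
  have small: "very_small_action G \<phi>" using assms(2) by (simp add: cv_bar_def)
  then have min: "minimal_action G \<phi>" and nontriv: "nontrivial_action G \<phi>"
    by (auto simp: very_small_action_def)
  interpret tree_action "TYPE('a)" G \<phi>
    using assms(2) small by unfold_locales (auto simp: cv_bar_def very_small_action_def)
  obtain a b :: 'a where ab: "a \<noteq> b" using nontriv unfolding nontrivial_action_def by metis
  obtain S where S: "finite S" "S \<subseteq> carrier G" "generate G S = carrier G"
    using assms(2) by (auto simp: cv_bar_def free_group_of_rank_def free_basis_def)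
  have X: "invariant_set G \<phi> X"
    and Xclosed: "\<And>K. finite_subtree K \<Longrightarrow> nondegenerate K \<Longrightarrow> closedin (top_of_set K) (X \<inter> K)"
    using assms(5) by (auto simp: exceptional_set_def)
  obtain K C where KC: "finite_subtree K" "C \<subseteq> X \<inter> K" "cantor_set C"
    using assms(5) unfolding exceptional_set_def by blast
  obtain \<I> where I: "finite \<I>" "\<forall>I\<in>\<I>. finite_arc I" "\<Union>\<I> = K"
    using KC(1) by (auto simp: finite_subtree_def arc_decomposition_def)
  \<comment> \<open>A Cantor set is infinite and K is a finite union of arcs, so some arc meets X in
    an infinite set.\<close>
  have "infinite (X \<inter> K)" using infinite_cantor_set[OF KC(3)] KC(2) finite_subset by blast
  moreover have "X \<inter> K = (\<Union>I\<in>\<I>. X \<inter> I)" using I(3) by blast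
  ultimately have "infinite (\<Union>I\<in>\<I>. X \<inter> I)" by simp
  then obtain I where "I \<in> \<I>" "infinite (X \<inter> I)"
    using finite_UN[OF I(1)] by blast
  then obtain p q where inf: "infinite (X \<inter> seg p q)"
    using I(2) by (auto simp: finite_arc_def geodesic_iff_seg)
  obtain l where l: "invariant_length TYPE('a) G \<phi> l" "\<And>p q. X \<inter> seg p q = {} \<Longrightarrow> l p q = 0"
    "\<exists>p q. l p q \<noteq> 0"
    by (rule invariant_length_exists[OF S min X inf]) blast
  interpret invariant_length "TYPE('a)" G \<phi> l by (rule l(1))
  \<comment> \<open>Here the absence of splittings enters: together with minimality it turns the
    additive length into a continuous one.\<close>
  interpret invariant_continuous_length "TYPE('a)" G \<phi> l
  proof
    fix y z :: 'a and m :: real assume "z \<noteq> y" "m > 0"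
    then obtain w where "w \<in> seg y z" "w \<noteq> y" "l y w < m"
      using small_length[OF assms(4) min] by blast
    then show "\<exists>w\<in>seg y z - {y}. l y w < m" by blast
  qed
  have "closedin (top_of_set (seg p q)) (X \<inter> seg p q)" if "p \<noteq> q" for p q :: 'a
  proof (rule Xclosed)
    have "arc_decomposition {seg p q} (seg p q)" by (auto simp: arc_decomposition_def finite_arc_iff)
    moreover have "seg p q \<noteq> {}" using seg_ends by blast
    ultimately show "finite_subtree (seg p q)"
      using connected_seg[of p q] by (auto simp: finite_subtree_def subtree_def)
    show "nondegenerate (seg p q)" using that seg_ends unfolding nondegenerate_def by metis
  qed
  then have "supported_on lmeasure X" using l(2) by (intro supported_on_lmeasure)
  moreover have "nonzero_length_measure lmeasure"
  proof -
    obtain p q where "l p q \<noteq> 0" using l(3) by blast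
    then have "emeasure (lmeasure (seg p q)) (seg p q) \<noteq> 0"
      using arc_measure_total[OF arc_measure_lmeasure, of p q] l_nonneg[of p q] by simp
    then show ?thesis by (auto simp: nonzero_length_measure_def finite_arc_iff)
  qed
  moreover have "lmeasure \<in> M0 G \<phi>"
    using invariant_lmeasure nonatomic_lmeasure by (simp add: M0_def)
  ultimately show ?thesis by blast
qed

end
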